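(* Let $P\subset\mathbb{R}^d$ be a set of $n$ points, $\gamma\in(0,1)$, $\epsilon,\eta_1,\eta_2\in(0,1)$, $\delta\in(0,\gamma/3)$, and $z=\frac{2}{\epsilon}+1$. Run the following algorithm: let $n'=O(\frac1\delta\log\frac1{\eta_1})$, $n''=O(\frac{\gamma}{\delta^2}\log\frac1{\eta_2})$ (with sufficiently large absolute constants), $t'=\frac32(\delta/5+\gamma)n'$, $t''=(1+\frac{\delta}{5\gamma})^2\gamma n''$, $s=\frac{\epsilon}{2+\epsilon}$; pick $p\in P$ uniformly at random and let $T=\{p\}$; for $i=1,\dots,z$: (1) compute an approximate MEB center $o_i$ of $T$, i.e. a point at distance less than $s\frac{\epsilon}{1+\epsilon}\mathbf{Rad}(T)$ from the center of $\mathbf{MEB}(T)$; (2) sample $n'$ points independently and uniformly at random from $P$ and let $Q'$ be the set of the $t'$ sampled points farthest from $o_i$; (3) pick $q\in Q'$ uniformly at random and add it to $T$; (4) sample $n''$ points independently and uniformly at random from $P$ and let $\tilde l_i$ be the $(t''+1)$-th largest distance from these sampled points to $o_i$. Output $\mathbb{B}(o_{\hat i},\tilde l_{\hat i})$ with $\hat i=\arg\min_{1\le i\le z}\tilde l_i$. Then with probability at least $(1-\gamma)\big((1-\eta_1)(1-\eta_2)\frac{\delta/5}{3(\gamma+\delta/5)}\big)^{z}$, the output is a $(1+\epsilon,1-\delta)$-approximation for the MEB with outliers instance $(P,\gamma)$.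
   Context: For a finite set $A\subset\mathbb{R}^d$, $\mathbf{MEB}(A)$ is the closed ball of minimum radius containing $A$ and $\mathbf{Rad}(A)$ its radius; $\mathbb{B}(c,r)$ is the closed Euclidean ball. MEB with outliers: given $n$ points $P\subset\mathbb{R}^d$ and $\gamma\in[0,1)$, find the smallest ball covering $(1-\gamma)n$ points of $P$; $P_{\mathrm{opt}}$ denotes a subset $Q\subset P$ with $|Q|=(1-\gamma)n$ minimizing $\mathbf{Rad}(Q)$. A $(1+\epsilon,1-\delta)$-approximation is a ball covering at least $(1-\delta-\gamma)n$ points of $P$ with radius at most $(1+\epsilon)\mathbf{Rad}(P_{\mathrm{opt}})$. Quantities such as $t',t''$ are assumed to be integers.
   Formalization: When Rad(T)=0 (always in round 1) no point is at distance less than 0 from the center, so o_i is taken to be the exact center; if t' exceeds n', Q' is the whole sample; if t''+1 exceeds n'', the distance estimate is 0. The constants in n', n'' may be any reals at least 10^9. *)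

theory Defs
  imports "HOL-Analysis.Analysis" "HOL-Probability.Probability"
begin

definition is_MEB :: "'a::metric_space set \<Rightarrow> 'a \<Rightarrow> real \<Rightarrow> bool" where
  "is_MEB A c r \<longleftrightarrow> A \<subseteq> cball c r \<and> (\<forall>c' r'. A \<subseteq> cball c' r' \<longrightarrow> r \<le> r')"

(* For a nonempty finite A in a Euclidean space both descriptions are uniquely satisfied. *)
definition Rad :: "'a::metric_space set \<Rightarrow> real" where
  "Rad A = (THE r. \<exists>c. is_MEB A c r)"

definition MEB_center :: "'a::metric_space set \<Rightarrow> 'a" where
  "MEB_center A = (THE c. is_MEB A c (Rad A))"

(* The existence of Q forces (1 - \<gamma>) * card P to be a natural number. *)
definition outlier_opt :: "'a::metric_space set \<Rightarrow> real \<Rightarrow> 'a set \<Rightarrow> bool" where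
  "outlier_opt P \<gamma> Q \<longleftrightarrow>
     Q \<subseteq> P \<and> real (card Q) = (1 - \<gamma>) * real (card P) \<and>
     (\<forall>Q'. Q' \<subseteq> P \<and> real (card Q') = (1 - \<gamma>) * real (card P) \<longrightarrow> Rad Q \<le> Rad Q')"

(* (1 + \<epsilon>, 1 - \<delta>)-approximation; the ball is given by its center and radius. *)
definition outlier_approx ::
  "'a::metric_space set \<Rightarrow> real \<Rightarrow> 'a set \<Rightarrow> real \<Rightarrow> real \<Rightarrow> 'a \<times> real \<Rightarrow> bool" where
  "outlier_approx P \<gamma> Popt \<epsilon> \<delta> B \<longleftrightarrow>
     real (card (P \<inter> cball (fst B) (snd B))) \<ge> (1 - \<delta> - \<gamma>) * real (card P) \<and>
     snd B \<le> (1 + \<epsilon>) * Rad Popt"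

(* If Rad T = 0 (in particular for the initial one-point T) no point has distance less than
   \<xi> * Rad T = 0 from the center, so the exact center is required there. *)
definition approx_MEB_center :: "real \<Rightarrow> 'a::metric_space set \<Rightarrow> 'a \<Rightarrow> bool" where
  "approx_MEB_center \<xi> T c \<longleftrightarrow>
     (if Rad T = 0 then c = MEB_center T else dist c (MEB_center T) < \<xi> * Rad T)"

(* Samples are drawn with replacement, so the selected sample points form a multiset; ties are
   broken arbitrarily, and the whole sample is selected if it has fewer than t points. *)
definition farthest_points :: "nat \<Rightarrow> 'a::metric_space \<Rightarrow> 'a list \<Rightarrow> 'a multiset \<Rightarrow> bool" where
  "farthest_points t c xs Q \<longleftrightarrow>
     Q \<subseteq># mset xs \<and> size Q = min t (length xs) \<and>
     (\<forall>x \<in># Q. \<forall>y \<in># mset xs - Q. dist y c \<le> dist x c)"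

(* k counts from 1. The value 0 beyond the end of the list is the least radius leaving at most
   k - 1 of the points outside when the distances to them are the entries of the list. *)
definition kth_largest :: "nat \<Rightarrow> real list \<Rightarrow> real" where
  "kth_largest k xs = (if 1 \<le> k \<and> k \<le> length xs then rev (sort xs) ! (k - 1) else 0)"

(* meb_rounds ... k T: the list of the pairs (o, l) produced by k rounds started with the set T.
   ctr is the approximate-center subroutine, far selects the farthest sample points. *)
primrec meb_rounds ::
  "'a::metric_space set \<Rightarrow> nat \<Rightarrow> nat \<Rightarrow> nat \<Rightarrow> ('a set \<Rightarrow> 'a) \<Rightarrow> ('a \<Rightarrow> 'a list \<Rightarrow> 'a multiset) \<Rightarrow>
   nat \<Rightarrow> 'a set \<Rightarrow> ('a \<times> real) list pmf" where
  "meb_rounds P n' n'' t'' ctr far 0 T = return_pmf []"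
| "meb_rounds P n' n'' t'' ctr far (Suc k) T =
     do {
       xs \<leftarrow> replicate_pmf n' (pmf_of_set P);
       q \<leftarrow> pmf_of_multiset (far (ctr T) xs);
       ys \<leftarrow> replicate_pmf n'' (pmf_of_set P);
       bs \<leftarrow> meb_rounds P n' n'' t'' ctr far k (insert q T);
       return_pmf ((ctr T, kth_largest (t'' + 1) (map (\<lambda>y. dist y (ctr T)) ys)) # bs)
     }"

definition meb_algorithm ::
  "'a::metric_space set \<Rightarrow> nat \<Rightarrow> nat \<Rightarrow> nat \<Rightarrow> ('a set \<Rightarrow> 'a) \<Rightarrow> ('a \<Rightarrow> 'a list \<Rightarrow> 'a multiset) \<Rightarrow>
   nat \<Rightarrow> ('a \<times> real) pmf" where
  "meb_algorithm P n' n'' t'' ctr far z =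
     do {
       p \<leftarrow> pmf_of_set P;
       bs \<leftarrow> meb_rounds P n' n'' t'' ctr far z {p};
       return_pmf (bs ! arg_min_on (\<lambda>i. snd (bs ! i)) {..<z})
     }"

end

theory Submission
  imports Defs
begin

text \<open>
  Call a round with center \<open>o\<close> good if at most \<open>(\<gamma> + \<delta>/5)n\<close> points of \<open>P\<close> lie outside the ball
  \<open>B(o, (1 + \<epsilon>)R)\<close>, where \<open>R = Rad Popt\<close>. In a bad round more than \<open>\<delta>n/5\<close> points of \<open>Popt\<close> lie
  outside this ball. Either all sampled ones are selected into \<open>Q'\<close>, or \<open>Q'\<close> lies entirely outside
  the ball and contains few outliers; in both cases \<open>q\<close> is one of these points with the required
  probability. Each such \<open>q\<close> enlarges \<open>Rad T\<close> so much that \<open>z\<close> bad rounds in a row would force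
  \<open>Rad T > R\<close>. Hence, starting from \<open>p \<in> Popt\<close>, some round is good. There the radius estimate is
  at most \<open>(1 + \<epsilon>)R\<close>, and in every round the estimated ball covers enough points; then the ball of
  least estimated radius is the required approximation.

  Exponential tail bounds are avoided. The number of selected points of \<open>Popt\<close> outside the ball is
  bounded in expectation, about twice the amount needed, and this leaves room for one-sided
  Chebyshev bounds on the radius estimates. In a good round no point \<open>q\<close> is needed, which frees
  the factor \<open>(\<delta>/5) / (3(\<gamma> + \<delta>/5))\<close>. When \<open>\<eta>\<^sub>1\<close> or \<open>\<eta>\<^sub>2\<close> is close to 1 the samples may be
  small, and there the bounds must be compared with \<open>1 - \<eta>\<^sub>i\<close>, which is then at most a small
  multiple of the sample size.
\<close>

subsection \<open>Minimum enclosing balls\<close>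

text \<open>Moving from \<open>c\<close> a fraction \<open>u\<close> towards \<open>c'\<close> gives
  a ball around \<open>T\<close> whose squared radius \<open>b\<close> is the convex combination of
  the two squares minus \<open>u * (1 - u)\<close> times the squared distance of the centers.
  Minimality gives \<open>r^2 \<le> b\<close>; dividing by \<open>u\<close> and letting
  \<open>u\<close> tend to 0 yields the claim.\<close>

lemma is_MEB_dist_center:
  fixes c c' :: "'a::real_inner"
  assumes meb: "is_MEB T c r" and ne: "T \<noteq> {}" and cov: "T \<subseteq> cball c' r'"
  shows "r\<^sup>2 + (dist c c')\<^sup>2 \<le> r'\<^sup>2"
proof -
  have r0: "0 \<le> r" and r'0: "0 \<le> r'"
    using meb ne cov unfolding is_MEB_def by (auto simp: subset_iff intro: order_trans[OF zero_le_dist])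
  have key: "r\<^sup>2 + (1 - u) * (dist c c')\<^sup>2 \<le> r'\<^sup>2" if u: "0 < u" "u < 1" for u :: real
  proof -
    define m where "m = (1 - u) *\<^sub>R c + u *\<^sub>R c'"
    define b where "b = (1 - u) * r\<^sup>2 + u * r'\<^sup>2 - u * (1 - u) * (dist c c')\<^sup>2"
    have b: "(dist m t)\<^sup>2 \<le> b" if t: "t \<in> T" for t
    proof -
      have "(dist m t)\<^sup>2 = (1 - u) * (dist c t)\<^sup>2 + u * (dist c' t)\<^sup>2 - u * (1 - u) * (dist c c')\<^sup>2"
        unfolding m_def dist_norm power2_norm_eq_inner
        by (simp add: algebra_simps inner_commute)
      moreover have "(dist c t)\<^sup>2 \<le> r\<^sup>2" "(dist c' t)\<^sup>2 \<le> r'\<^sup>2"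
        using meb cov t unfolding is_MEB_def by (auto intro!: power_mono)
      ultimately show ?thesis
        unfolding b_def using u by (smt (verit) mult_left_mono)
    qed
    have "T \<subseteq> cball m (sqrt b)"
      using b by (auto intro!: real_le_rsqrt)
    then have "r \<le> sqrt b"
      using meb unfolding is_MEB_def by blast
    moreover have "0 \<le> b"
      using b ne by (meson all_not_in_conv order_trans zero_le_power2)
    ultimately have "r\<^sup>2 \<le> b"
      using r0 by (metis power_mono real_sqrt_pow2)
    then have "u * (r\<^sup>2 + (1 - u) * (dist c c')\<^sup>2) \<le> u * r'\<^sup>2"
      unfolding b_def by (simp add: algebra_simps)
    then show ?thesis
      using u by (simp only: mult_le_cancel_left_pos)
  qed
  have "((\<lambda>u. r\<^sup>2 + (1 - u) * (dist c c')\<^sup>2) \<longlongrightarrow> r\<^sup>2 + (1 - 0) * (dist c c')\<^sup>2) (at_right (0::real))"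
    by (intro tendsto_intros)
  moreover have "\<forall>\<^sub>F u in at_right (0::real). r\<^sup>2 + (1 - u) * (dist c c')\<^sup>2 \<le> r'\<^sup>2"
    using eventually_at_right_real[of 0 1] by (auto elim!: eventually_mono intro!: key)
  ultimately show ?thesis
    using tendsto_upperbound[of _ _ "at_right (0::real)"] by fastforce
qed

text \<open>Compactness: the pairs of a center and a covering radius bounded by \<open>D\<close>
  form a closed bounded set, on which the radius attains its minimum. The ball of radius
  \<open>D\<close> about a point of \<open>T\<close> shows that this set is nonempty.\<close>

lemma is_MEB_exists:
  fixes T :: "'a::euclidean_space set"
  assumes "finite T" "T \<noteq> {}"
  shows "\<exists>c r. is_MEB T c r"
proof -
  obtain p where p: "p \<in> T" using assms by blast
  define D where "D = Max (dist p ` T)"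
  have D: "dist p t \<le> D" if "t \<in> T" for t
    unfolding D_def using assms that by auto
  define S where "S = {x :: 'a \<times> real. (\<forall>t\<in>T. dist (fst x) t \<le> snd x) \<and> snd x \<le> D}"
  have "closed {x :: 'a \<times> real. dist (fst x) t \<le> snd x}" for t
    by (intro closed_Collect_le continuous_intros)
  then have "closed ((\<Inter>t\<in>T. {x :: 'a \<times> real. dist (fst x) t \<le> snd x}) \<inter> {x. snd x \<le> D})"
    by (intro closed_Int closed_INT closed_Collect_le continuous_intros ballI)
  moreover have "S = (\<Inter>t\<in>T. {x :: 'a \<times> real. dist (fst x) t \<le> snd x}) \<inter> {x. snd x \<le> D}"
    unfolding S_def by auto
  ultimately have "closed S" by simp
  moreover have "S \<subseteq> cball p D \<times> {0..D}"
  proof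
    fix x assume "x \<in> S"
    then have "dist (fst x) p \<le> snd x" "snd x \<le> D" using p unfolding S_def by auto
    moreover from this have "0 \<le> snd x" by (meson order_trans zero_le_dist)
    ultimately show "x \<in> cball p D \<times> {0..D}"
      by (cases x) (auto simp: dist_commute)
  qed
  then have "bounded S"
    by (rule bounded_subset[OF bounded_Times[OF bounded_cball bounded_closed_interval]])
  ultimately have "compact S" by (simp add: compact_eq_bounded_closed)
  moreover have "(p, D) \<in> S" unfolding S_def using D by auto
  ultimately obtain x where x: "x \<in> S" "\<forall>y\<in>S. snd x \<le> snd y"
    using continuous_attains_inf[of S snd] continuous_on_snd[OF continuous_on_id, of S] by blast
  have "snd x \<le> r'" if "T \<subseteq> cball c' r'" for c' r'
  proof (cases "r' \<le> D")
    case True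
    then have "(c', r') \<in> S" unfolding S_def using that by auto
    then show ?thesis using x by auto
  next
    case False
    then show ?thesis using x unfolding S_def by auto
  qed
  then have "is_MEB T (fst x) (snd x)"
    using x unfolding is_MEB_def S_def by auto
  then show ?thesis by blast
qed

text \<open>Justifies both definite descriptions. Minimality determines the radius; for two centers
  with equal radii \<open>is_MEB_dist_center\<close> forces their distance to be 0.\<close>

lemma is_MEB_MEB_center_Rad:
  fixes T :: "'a::euclidean_space set"
  assumes "finite T" "T \<noteq> {}"
  shows "is_MEB T (MEB_center T) (Rad T)"
proof -
  obtain c r where cr: "is_MEB T c r" using is_MEB_exists[OF assms] by blast
  have r: "r' = r" if "is_MEB T c' r'" for c' r'
    using that cr unfolding is_MEB_def by (meson order_antisym)
  then have R: "Rad T = r"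
    unfolding Rad_def using cr by blast
  have "c' = c" if "is_MEB T c' r" for c'
    using is_MEB_dist_center[OF cr assms(2), of c' r] that unfolding is_MEB_def by auto
  then have "MEB_center T = c"
    unfolding MEB_center_def R using cr by blast
  then show ?thesis using cr R by simp
qed

lemma Rad_nonneg:
  fixes T :: "'a::euclidean_space set"
  assumes "finite T" "T \<noteq> {}"
  shows "0 \<le> Rad T"
  using is_MEB_MEB_center_Rad[OF assms] assms(2) unfolding is_MEB_def
  by (auto simp: subset_iff intro: order_trans[OF zero_le_dist])

lemma Rad_mono:
  fixes T :: "'a::euclidean_space set"
  assumes "finite U" "T \<subseteq> U" "T \<noteq> {}"
  shows "Rad T \<le> Rad U"
proof -
  have "is_MEB T (MEB_center T) (Rad T)" "is_MEB U (MEB_center U) (Rad U)"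
    using assms by (auto intro!: is_MEB_MEB_center_Rad intro: finite_subset)
  then show ?thesis
    using assms(2) unfolding is_MEB_def by (meson subset_trans)
qed

text \<open>\<open>K\<close> is the displacement of the center: the first inequality is the
  Pythagorean growth of \<open>is_MEB_dist_center\<close>, the second the triangle
  inequality.\<close>

lemma Rad_insert:
  fixes T :: "'a::euclidean_space set"
  assumes "finite T" "T \<noteq> {}"
  shows "\<exists>K\<ge>0. (Rad T)\<^sup>2 + K\<^sup>2 \<le> (Rad (insert q T))\<^sup>2 \<and> dist q (MEB_center T) - K \<le> Rad (insert q T)"
proof (intro exI conjI)
  let ?c = "MEB_center T" and ?c' = "MEB_center (insert q T)"
  have m: "is_MEB (insert q T) ?c' (Rad (insert q T))"
    using is_MEB_MEB_center_Rad[of "insert q T"] assms by auto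
  then show "(Rad T)\<^sup>2 + (dist ?c ?c')\<^sup>2 \<le> (Rad (insert q T))\<^sup>2"
    using is_MEB_dist_center[OF is_MEB_MEB_center_Rad[OF assms] assms(2)]
    unfolding is_MEB_def by auto
  have "dist q ?c' \<le> Rad (insert q T)"
    using m unfolding is_MEB_def by (auto simp: dist_commute)
  then show "dist q ?c - dist ?c ?c' \<le> Rad (insert q T)"
    using dist_triangle[of q ?c ?c'] by (simp add: dist_commute)
qed simp

text \<open>Step of the induction for \<open>r / M \<ge> j / (j + 2)\<close>. A small displacement
  \<open>K\<close> makes \<open>r'\<close> large through \<open>tri\<close>, a large one through
  \<open>sq\<close>. If \<open>r'\<close> stayed below the target, \<open>K\<close> would exceed
  \<open>2 * M / (j + 3)\<close>, which is incompatible with \<open>sq\<close>.\<close>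

lemma radius_growth:
  fixes r r' K D M j :: real
  assumes "0 \<le> r" "0 \<le> r'" "0 \<le> K" "0 \<le> M" "M < D" "0 \<le> j"
    and sq: "r\<^sup>2 + K\<^sup>2 \<le> r'\<^sup>2" and tri: "D - K \<le> r'" and ih: "M * j \<le> r * (j + 2)"
  shows "M * (j + 1) < r' * (j + 3)"
proof (rule ccontr)
  assume "\<not> ?thesis"
  then have le: "r' \<le> M * (j + 1) / (j + 3)" using \<open>0 \<le> j\<close> by (simp add: field_simps)
  have "M * 2 / (j + 3) = M - M * (j + 1) / (j + 3)" using \<open>0 \<le> j\<close> by (simp add: field_simps)
  also have "\<dots> \<le> M - r'" using le by (rule diff_left_mono)
  also have "\<dots> < K" using tri \<open>M < D\<close> by linarith
  finally have "M * 2 / (j + 3) < K" .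
  then have K: "(M * 2 / (j + 3))\<^sup>2 < K\<^sup>2"
    using \<open>0 \<le> M\<close> \<open>0 \<le> j\<close> by (intro power_strict_mono) auto
  have "M * j / (j + 2) \<le> r" using ih \<open>0 \<le> j\<close> by (simp add: field_simps)
  then have r: "(M * j / (j + 2))\<^sup>2 \<le> r\<^sup>2"
    using \<open>0 \<le> M\<close> \<open>0 \<le> j\<close> by (intro power_mono) auto
  have r': "r'\<^sup>2 \<le> (M * (j + 1) / (j + 3))\<^sup>2"
    using le \<open>0 \<le> r'\<close> by (intro power_mono) auto
  \<comment> \<open>With \<open>u = j^2 + 3 * j\<close> the left side is \<open>(u + 2)^2\<close>,
    and the right side is larger by \<open>4 * j + 12\<close>.\<close>
  have "(j + 1)\<^sup>2 * (j + 2)\<^sup>2 \<le> j\<^sup>2 * (j + 3)\<^sup>2 + 2\<^sup>2 * (j + 2)\<^sup>2"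
    using \<open>0 \<le> j\<close> by (simp add: power2_eq_square algebra_simps)
  then have "(j + 1)\<^sup>2 * (j + 2)\<^sup>2 / ((j + 2)\<^sup>2 * (j + 3)\<^sup>2)
      \<le> (j\<^sup>2 * (j + 3)\<^sup>2 + 2\<^sup>2 * (j + 2)\<^sup>2) / ((j + 2)\<^sup>2 * (j + 3)\<^sup>2)"
    by (rule divide_right_mono) simp
  then have "((j + 1) / (j + 3))\<^sup>2 \<le> (j / (j + 2))\<^sup>2 + (2 / (j + 3))\<^sup>2"
    using \<open>0 \<le> j\<close> by (simp add: power_divide add_divide_distrib[of "_ * _" "_ * _"])
  then have "M\<^sup>2 * ((j + 1) / (j + 3))\<^sup>2 \<le> M\<^sup>2 * ((j / (j + 2))\<^sup>2 + (2 / (j + 3))\<^sup>2)"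
    by (intro mult_left_mono) auto
  then have "(M * (j + 1) / (j + 3))\<^sup>2 \<le> (M * j / (j + 2))\<^sup>2 + (M * 2 / (j + 3))\<^sup>2"
    by (simp add: power_mult_distrib power_divide distrib_left[of "M\<^sup>2"])
  then show False using K r r' sq by linarith
qed

subsection \<open>Order statistics\<close>

lemma kth_largest_le:
  assumes "length (filter (\<lambda>x. r < x) xs) \<le> t" "0 \<le> r"
  shows "kth_largest (t + 1) xs \<le> r"
proof (cases "t < length xs")
  case True
  define ys where "ys = rev (sort xs)"
  have len: "length ys = length xs" and srt: "sorted (rev ys)"
    unfolding ys_def by auto
  have "length (filter (\<lambda>x. r < x) ys) = length (filter (\<lambda>x. r < x) xs)"
    unfolding ys_def by (metis mset_filter mset_rev mset_sort size_mset)
  then have c: "card {i. i < length ys \<and> r < ys ! i} \<le> t"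
    using assms by (simp add: length_filter_conv_card)
  have "ys ! t \<le> r"
  proof (rule ccontr)
    assume "\<not> ?thesis"
    then have "{..t} \<subseteq> {i. i < length ys \<and> r < ys ! i}"
      using True len sorted_rev_nth_mono[OF srt] by (auto; meson le_less_trans less_le_trans not_le)
    then have "card {..t} \<le> card {i. i < length ys \<and> r < ys ! i}"
      by (intro card_mono) auto
    then show False using c by simp
  qed
  then show ?thesis using True unfolding kth_largest_def ys_def by simp
\<comment> \<open>With at most \<open>t\<close> entries the value is the default 0, which
  \<open>0 \<le> r\<close> covers.\<close>
qed (use assms in \<open>auto simp: kth_largest_def\<close>)

lemma kth_largest_ge:
  assumes "t < length (filter (\<lambda>x. r \<le> x) xs)"
  shows "r \<le> kth_largest (t + 1) xs"
proof -
  define ys where "ys = rev (sort xs)"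
  have len: "length ys = length xs" and srt: "sorted (rev ys)"
    unfolding ys_def by auto
  have t: "t < length xs"
    using assms length_filter_le[of "\<lambda>x. r \<le> x" xs] by linarith
  have "length (filter (\<lambda>x. r \<le> x) ys) = length (filter (\<lambda>x. r \<le> x) xs)"
    unfolding ys_def by (metis mset_filter mset_rev mset_sort size_mset)
  then have c: "t < card {i. i < length ys \<and> r \<le> ys ! i}"
    using assms by (simp add: length_filter_conv_card)
  have "r \<le> ys ! t"
  proof (rule ccontr)
    assume "\<not> ?thesis"
    then have "{i. i < length ys \<and> r \<le> ys ! i} \<subseteq> {..<t}"
      using t len sorted_rev_nth_mono[OF srt] by (auto; meson order_trans not_le)
    then have "card {i. i < length ys \<and> r \<le> ys ! i} \<le> card {..<t}"
      by (intro card_mono) auto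
    then show False using c by simp
  qed
  then show ?thesis using t unfolding kth_largest_def ys_def by simp
qed

subsection \<open>Independent samples\<close>

text \<open>Outcomes outside \<open>S\<close> contribute at least 0. In this form the success
  probabilities of successive random choices multiply.\<close>

lemma prob_bind_pmf_ge:
  assumes "0 \<le> c" and "\<And>x. x \<in> set_pmf p \<Longrightarrow> x \<in> S \<Longrightarrow> c \<le> measure_pmf.prob (f x) E"
  shows "measure_pmf.prob p S * c \<le> measure_pmf.prob (bind_pmf p f) E"
proof -
  have "ennreal (measure_pmf.prob p S * c) = (\<integral>\<^sup>+x. ennreal c * indicator S x \<partial>p)"
    using assms(1) by (simp add: nn_integral_cmult measure_pmf.emeasure_eq_measure ennreal_mult'' mult.commute)
  also have "\<dots> \<le> (\<integral>\<^sup>+x. emeasure (f x) E \<partial>p)"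
    using assms(2) by (intro nn_integral_mono_AE)
      (auto simp: AE_measure_pmf_iff indicator_def measure_pmf.emeasure_eq_measure intro!: ennreal_leI)
  also have "\<dots> = emeasure (bind_pmf p f) E" by simp
  finally show ?thesis
    by (simp add: measure_pmf.emeasure_eq_measure)
qed

lemma finite_set_replicate_pmf:
  assumes "finite (set_pmf p)"
  shows "finite (set_pmf (replicate_pmf n p))"
  using finite_lists_length_eq[OF assms, of n]
  by (auto simp: set_replicate_pmf lists_eq_set)

lemma expectation_bind_pmf_finite:
  fixes h :: "'b \<Rightarrow> real"
  assumes "finite (set_pmf p)" "\<And>x. x \<in> set_pmf p \<Longrightarrow> finite (set_pmf (f x))"
  shows "measure_pmf.expectation (bind_pmf p f) h =
         measure_pmf.expectation p (\<lambda>x. measure_pmf.expectation (f x) h)"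
  using assms
  by (simp add: pmf_expectation_bind[of "set_pmf p"] integral_measure_pmf[of "set_pmf p"])

lemma expectation_replicate_pmf_Suc:
  fixes h :: "'a list \<Rightarrow> real"
  assumes "finite (set_pmf p)"
  shows "measure_pmf.expectation (replicate_pmf (Suc n) p) h =
         measure_pmf.expectation p (\<lambda>x. measure_pmf.expectation (replicate_pmf n p) (\<lambda>xs. h (x # xs)))"
proof -
  have "replicate_pmf (Suc n) p = bind_pmf p (\<lambda>x. map_pmf ((#) x) (replicate_pmf n p))"
    by (simp add: map_pmf_def)
  then show ?thesis
    using assms finite_set_replicate_pmf[OF assms]
    by (simp add: expectation_bind_pmf_finite)
qed

lemma expectation_replicate_pmf_sum:
  fixes f :: "'a \<Rightarrow> real"
  assumes "finite (set_pmf p)"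
  shows "measure_pmf.expectation (replicate_pmf n p) (\<lambda>xs. \<Sum>x\<leftarrow>xs. f x) =
         n * measure_pmf.expectation p f"
proof (induction n)
  case (Suc n)
  note int = integrable_measure_pmf_finite[OF finite_set_replicate_pmf[OF assms]]
    integrable_measure_pmf_finite[OF assms]
  show ?case
    unfolding expectation_replicate_pmf_Suc[OF assms]
    by (simp add: int Suc algebra_simps)
qed simp

text \<open>Of the pairs of positions in the sample, \<open>n\<close> are diagonal and
  \<open>n * (n - 1)\<close> consist of distinct, hence independent, positions. The induction splits
  off the first sample point.\<close>

lemma expectation_replicate_pmf_sum_mult:
  fixes f g :: "'a \<Rightarrow> real"
  assumes "finite (set_pmf p)"
  shows "measure_pmf.expectation (replicate_pmf n p) (\<lambda>xs. (\<Sum>x\<leftarrow>xs. f x) * (\<Sum>x\<leftarrow>xs. g x)) =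
         n * measure_pmf.expectation p (\<lambda>x. f x * g x) +
         real n * (real n - 1) * (measure_pmf.expectation p f * measure_pmf.expectation p g)"
proof (induction n)
  case (Suc n)
  note int = integrable_measure_pmf_finite[OF finite_set_replicate_pmf[OF assms]]
    integrable_measure_pmf_finite[OF assms]
  have "measure_pmf.expectation (replicate_pmf (Suc n) p) (\<lambda>xs. (\<Sum>x\<leftarrow>xs. f x) * (\<Sum>x\<leftarrow>xs. g x)) =
     measure_pmf.expectation p (\<lambda>x. measure_pmf.expectation (replicate_pmf n p)
       (\<lambda>xs. f x * g x + f x * (\<Sum>x\<leftarrow>xs. g x) + g x * (\<Sum>x\<leftarrow>xs. f x) + (\<Sum>x\<leftarrow>xs. f x) * (\<Sum>x\<leftarrow>xs. g x)))"
    unfolding expectation_replicate_pmf_Suc[OF assms] by (simp add: algebra_simps)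
  also have "\<dots> = measure_pmf.expectation p (\<lambda>x. f x * g x + f x * (n * measure_pmf.expectation p g)
      + g x * (n * measure_pmf.expectation p f) + (n * measure_pmf.expectation p (\<lambda>x. f x * g x) +
         real n * (real n - 1) * (measure_pmf.expectation p f * measure_pmf.expectation p g)))"
    by (simp add: int Suc expectation_replicate_pmf_sum[OF assms])
  also have "\<dots> = measure_pmf.expectation p (\<lambda>x. f x * g x) + measure_pmf.expectation p f * (n * measure_pmf.expectation p g)
      + measure_pmf.expectation p g * (n * measure_pmf.expectation p f) + (n * measure_pmf.expectation p (\<lambda>x. f x * g x) +
         real n * (real n - 1) * (measure_pmf.expectation p f * measure_pmf.expectation p g))"
    by (simp add: int)
  finally show ?case by (simp add: algebra_simps)
qed simp

section \<open>Moments of the number of hits and one-sided tail bounds\<close>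

definition hits :: "'a set \<Rightarrow> 'a list \<Rightarrow> nat" where
  "hits S xs = length (filter (\<lambda>x. x \<in> S) xs)"

lemma hits_eq_sum_list: "real (hits S xs) = (\<Sum>x\<leftarrow>xs. indicator S x)"
  unfolding hits_def by (induction xs) auto

lemma hits_mono: "S \<subseteq> S' \<Longrightarrow> hits S xs \<le> hits S' xs"
  unfolding hits_def by (induction xs) auto

lemma expectation_hits:
  assumes "finite (set_pmf p)"
  shows "measure_pmf.expectation (replicate_pmf n p) (\<lambda>xs. real (hits S xs)) = n * measure_pmf.prob p S"
  unfolding hits_eq_sum_list by (simp add: expectation_replicate_pmf_sum[OF assms])

lemma expectation_hits_mult:
  assumes "finite (set_pmf p)"
  shows "measure_pmf.expectation (replicate_pmf n p) (\<lambda>xs. real (hits S xs) * real (hits S' xs)) =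
    n * measure_pmf.prob p (S \<inter> S') + real n * (real n - 1) * (measure_pmf.prob p S * measure_pmf.prob p S')"
  unfolding hits_eq_sum_list
  by (simp add: expectation_replicate_pmf_sum_mult[OF assms] flip: indicator_inter_arith)

text \<open>The exact variance is \<open>n * h * (1 - h)\<close> for the mass \<open>h\<close> of
  \<open>S\<close>; only the bound by the mean is kept.\<close>

lemma variance_hits_le:
  assumes "finite (set_pmf p)"
  shows "measure_pmf.expectation (replicate_pmf n p) (\<lambda>xs. (real (hits S xs) - n * measure_pmf.prob p S)\<^sup>2)
    \<le> n * measure_pmf.prob p S"
proof -
  note int = integrable_measure_pmf_finite[OF finite_set_replicate_pmf[OF assms]]
  let ?m = "n * measure_pmf.prob p S"
  have "measure_pmf.expectation (replicate_pmf n p) (\<lambda>xs. (real (hits S xs) - ?m)\<^sup>2) =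
    measure_pmf.expectation (replicate_pmf n p) (\<lambda>xs. real (hits S xs) * real (hits S xs)
      - 2 * ?m * real (hits S xs) + ?m\<^sup>2)"
    by (simp add: power2_eq_square algebra_simps)
  also have "\<dots> = ?m - n * (measure_pmf.prob p S)\<^sup>2"
    by (simp add: int expectation_hits[OF assms] expectation_hits_mult[OF assms])
       (simp add: power2_eq_square algebra_simps)
  finally show ?thesis by simp
qed

text \<open>The indicator of the event is bounded below by a parabola centred off the mean, at
  \<open>\<mu> - v / d\<close>.\<close>

lemma cantelli_upper:
  fixes Z :: "'a \<Rightarrow> real"
  assumes fin: "finite (set_pmf p)" and mean: "measure_pmf.expectation p Z = \<mu>"
    and var: "measure_pmf.expectation p (\<lambda>x. (Z x - \<mu>)\<^sup>2) \<le> v" and "0 \<le> v" "0 < d"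
  shows "d\<^sup>2 / (d\<^sup>2 + v) \<le> measure_pmf.prob p {x. Z x < \<mu> + d}"
proof -
  note int = integrable_measure_pmf_finite[OF fin]
  \<comment> \<open>This shift minimizes \<open>(v + c^2) / (d + c)^2\<close>.\<close>
  define c where "c = v / d"
  have c: "0 \<le> c" unfolding c_def using assms by simp
  let ?Q = "\<lambda>x. 1 - ((Z x - \<mu>)\<^sup>2 + 2 * c * (Z x - \<mu>) + c\<^sup>2) / (d + c)\<^sup>2"
  have "measure_pmf.expectation p ?Q =
      1 - (measure_pmf.expectation p (\<lambda>x. (Z x - \<mu>)\<^sup>2) + c\<^sup>2) / (d + c)\<^sup>2"
    using mean by (simp add: int)
  also have "\<dots> \<ge> 1 - (v + c\<^sup>2) / (d + c)\<^sup>2"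
    using var by (simp add: divide_right_mono)
  moreover have "1 - (v + c\<^sup>2) / (d + c)\<^sup>2 = d\<^sup>2 / (d\<^sup>2 + v)"
  proof -
    have 1: "v + c\<^sup>2 = v * (d\<^sup>2 + v) / d\<^sup>2" "d + c = (d\<^sup>2 + v) / d"
      unfolding c_def using \<open>0 < d\<close> by (simp_all add: field_simps power2_eq_square)
    define e where "e = d\<^sup>2 + v"
    have e: "0 < e" unfolding e_def using assms by (simp add: add_pos_nonneg)
    have "(v * e / d\<^sup>2) / (e / d)\<^sup>2 = v / e"
      using e \<open>0 < d\<close> by (simp add: power_divide power2_eq_square)
    then show ?thesis
      unfolding 1 e_def[symmetric] using e by (simp add: diff_divide_distrib e_def field_simps)
  qed
  moreover have "measure_pmf.expectation p ?Q \<le> measure_pmf.expectation p (indicator {x. Z x < \<mu> + d})"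
  proof (rule integral_mono[OF int int])
    fix x
    have eq: "(Z x - \<mu>)\<^sup>2 + 2 * c * (Z x - \<mu>) + c\<^sup>2 = (Z x - \<mu> + c)\<^sup>2"
      by (simp add: power2_eq_square algebra_simps)
    show "?Q x \<le> indicator {x. Z x < \<mu> + d} x"
    proof (cases "Z x < \<mu> + d")
      case True
      then show ?thesis unfolding eq by simp
    next
      case False
      then have "(d + c)\<^sup>2 \<le> (Z x - \<mu> + c)\<^sup>2"
        using c \<open>0 < d\<close> by (intro power_mono) auto
      then show ?thesis using False c \<open>0 < d\<close> unfolding eq by (simp add: field_simps)
    qed
  qed
  ultimately show ?thesis by simp
qed

lemma cantelli_lower:
  fixes Z :: "'a \<Rightarrow> real"
  assumes fin: "finite (set_pmf p)" and mean: "measure_pmf.expectation p Z = \<mu>"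
    and var: "measure_pmf.expectation p (\<lambda>x. (Z x - \<mu>)\<^sup>2) \<le> v" and "0 \<le> v" "0 < d"
  shows "d\<^sup>2 / (d\<^sup>2 + v) \<le> measure_pmf.prob p {x. \<mu> - d < Z x}"
proof -
  have "measure_pmf.expectation p (\<lambda>x. (- Z x - - \<mu>)\<^sup>2) \<le> v"
    using var by (simp add: power2_commute)
  then have "d\<^sup>2 / (d\<^sup>2 + v) \<le> measure_pmf.prob p {x. - Z x < - \<mu> + d}"
    using mean assms by (intro cantelli_upper) auto
  moreover have "{x. - Z x < - \<mu> + d} = {x. \<mu> - d < Z x}" by auto
  ultimately show ?thesis by simp
qed

text \<open>The function \<open>s / (s + 1)\<close> increases with \<open>s = a / m\<close>; the
  comparison of the quotients is cross-multiplied so that \<open>m\<close> and \<open>n\<close> may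
  vanish.\<close>

lemma ratio_add_mono:
  fixes a b m n :: real
  assumes "a * n \<le> b * m" "0 < a + m" "0 < b + n"
  shows "a / (a + m) \<le> b / (b + n)"
  using assms by (simp add: pos_divide_le_eq pos_le_divide_eq algebra_simps)

text \<open>The one-sided Chebyshev bound with deviation \<open>t - \<mu>\<close>. A smaller mean
  increases the deviation and decreases the variance bound, so \<open>m\<close> may replace the
  mean.\<close>

lemma prob_hits_le_ge:
  fixes t :: nat and m :: real
  assumes "finite (set_pmf p)" "n * measure_pmf.prob p S \<le> m" "m < t"
  shows "(t - m)\<^sup>2 / ((t - m)\<^sup>2 + m) \<le> measure_pmf.prob (replicate_pmf n p) {xs. hits S xs \<le> t}"
proof -
  let ?\<mu> = "n * measure_pmf.prob p S"
  have m: "0 \<le> ?\<mu>" "0 \<le> m" using assms(2) by (auto intro: order_trans[rotated])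
  have a: "0 < (t - m)\<^sup>2 + m" "0 < (t - ?\<mu>)\<^sup>2 + ?\<mu>"
    using assms m by (auto intro!: add_pos_nonneg)
  have "(t - m)\<^sup>2 \<le> (t - ?\<mu>)\<^sup>2" using assms m by (intro power_mono) auto
  then have "(t - m)\<^sup>2 * ?\<mu> \<le> (t - ?\<mu>)\<^sup>2 * m" using assms m by (intro mult_mono) auto
  then have "(t - m)\<^sup>2 / ((t - m)\<^sup>2 + m) \<le> (t - ?\<mu>)\<^sup>2 / ((t - ?\<mu>)\<^sup>2 + ?\<mu>)"
    using a by (intro ratio_add_mono)
  also have "\<dots> \<le> measure_pmf.prob (replicate_pmf n p) {xs. real (hits S xs) < ?\<mu> + (t - ?\<mu>)}"
    using assms m
    by (intro cantelli_upper[OF finite_set_replicate_pmf expectation_hits variance_hits_le]) auto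
  also have "\<dots> \<le> measure_pmf.prob (replicate_pmf n p) {xs. hits S xs \<le> t}"
    by (intro measure_pmf.finite_measure_mono) auto
  finally show ?thesis .
qed

text \<open>Here the variance bound grows together with the mean. Monotonicity is therefore checked
  with the mean written as \<open>t + d\<close>: the quotient \<open>d^2 / (t + d)\<close> increases
  with \<open>d\<close>.\<close>

lemma prob_hits_greater_ge:
  fixes t :: nat and m :: real
  assumes "finite (set_pmf p)" "m \<le> n * measure_pmf.prob p S" "t < m"
  shows "(m - t)\<^sup>2 / ((m - t)\<^sup>2 + m) \<le> measure_pmf.prob (replicate_pmf n p) {xs. t < hits S xs}"
proof -
  let ?\<mu> = "n * measure_pmf.prob p S"
  define d d' where "d = m - t" and "d' = ?\<mu> - t"
  have d: "0 < d" "d \<le> d'" unfolding d_def d'_def using assms by auto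
  have a: "0 < d\<^sup>2 + (t + d)" "0 < d'\<^sup>2 + (t + d')"
    using d by (simp_all add: add_nonneg_pos)
  have "d\<^sup>2 * t \<le> d'\<^sup>2 * t" using d by (intro mult_right_mono power_mono) auto
  moreover have "d * d' * d \<le> d * d' * d'" using d by (intro mult_left_mono) auto
  ultimately have "d\<^sup>2 * (t + d') \<le> d'\<^sup>2 * (t + d)"
    by (simp add: algebra_simps power2_eq_square)
  then have "d\<^sup>2 / (d\<^sup>2 + (t + d)) \<le> d'\<^sup>2 / (d'\<^sup>2 + (t + d'))"
    using a by (intro ratio_add_mono)
  also have "\<dots> = d'\<^sup>2 / (d'\<^sup>2 + ?\<mu>)" unfolding d'_def by simp
  also have "\<dots> \<le> measure_pmf.prob (replicate_pmf n p) {xs. ?\<mu> - d' < real (hits S xs)}"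
    using assms d
    by (intro cantelli_lower[OF finite_set_replicate_pmf expectation_hits variance_hits_le]) auto
  also have "\<dots> = measure_pmf.prob (replicate_pmf n p) {xs. t < hits S xs}"
    unfolding d'_def by simp
  finally show ?thesis unfolding d_def by simp
qed

subsection \<open>Binomial tails\<close>

text \<open>The variance of the binomial distribution, from its first two factorial moments.\<close>

lemma sum_Bernstein_variance:
  "(\<Sum>k\<le>n. (real k - n * x)\<^sup>2 * Bernstein n k x) = n * x * (1 - x)"
proof -
  have "(\<Sum>k\<le>n. (real k - n * x)\<^sup>2 * Bernstein n k x) =
    (\<Sum>k\<le>n. real k * (real k - 1) * Bernstein n k x + (1 - 2 * n * x) * (real k * Bernstein n k x)
       + (n * x)\<^sup>2 * Bernstein n k x)"
    by (intro sum.cong) (auto simp: power2_eq_square algebra_simps)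
  also have "\<dots> = real n * (real n - 1) * x\<^sup>2 + (1 - 2 * n * x) * (n * x) + (n * x)\<^sup>2"
    by (simp add: sum.distrib flip: sum_distrib_left)
  finally show ?thesis by (simp add: power2_eq_square algebra_simps)
qed

lemma Bernstein_Suc_ratio:
  fixes x :: real
  assumes "k < n"
  shows "Bernstein n (Suc k) x * ((Suc k) * (1 - x)) = Bernstein n k x * ((n - k) * x)"
proof -
  have "n - k = Suc (n - Suc k)" using assms by simp
  then have p: "(1 - x) ^ (n - k) = (1 - x) * (1 - x) ^ (n - Suc k)" by (simp only: power_Suc)
  have c: "real (n choose Suc k) * (Suc k) = real (n choose k) * real (n - k)"
    using arg_cong[OF trans[OF binomial_absorption binomial_absorb_comp[symmetric]], of real, of k n]
    by (simp only: of_nat_mult mult.commute)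
  have "Bernstein n (Suc k) x * ((Suc k) * (1 - x)) =
      (real (n choose Suc k) * (Suc k)) * x ^ k * x * ((1 - x) * (1 - x) ^ (n - Suc k))"
    unfolding Bernstein_def by (simp add: algebra_simps)
  also have "\<dots> = Bernstein n k x * (real (n - k) * x)"
    unfolding c Bernstein_def p by (simp add: algebra_simps del: of_nat_diff)
  also have "real (n - k) = real n - real k"
    using assms by simp
  finally show ?thesis .
qed

text \<open>By the ratio of neighbouring masses, the step from \<open>j\<close> to
  \<open>j + 1\<close> does not decrease the mass while \<open>j + 1 \<le> (n + 1) * x\<close>, and
  does not increase it afterwards.\<close>

lemma Bernstein_le_mode:
  fixes x :: real
  assumes x: "0 < x" "x < 1" and t: "t \<le> n" and mode: "t \<le> (real n + 1) * x" "(real n + 1) * x \<le> t + 1"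
  shows "Bernstein n k x \<le> Bernstein n t x"
proof -
  have up: "Bernstein n j x \<le> Bernstein n (Suc j) x" if "j < t" for j
  proof -
    have "(Suc j) * (1 - x) \<le> (real n - real j) * x"
    proof -
      have "real (Suc j) \<le> (real n + 1) * x" using mode that by linarith
      moreover have "real (n - j) = real n - j" using that t by simp
      ultimately show ?thesis by (simp add: algebra_simps)
    qed
    then have "Bernstein n j x * ((Suc j) * (1 - x)) \<le> Bernstein n j x * ((real n - real j) * x)"
      using x by (intro mult_left_mono Bernstein_nonneg) auto
    also have "\<dots> = Bernstein n (Suc j) x * ((Suc j) * (1 - x))"
      using Bernstein_Suc_ratio[of j n x] that t by simp
    finally show ?thesis using x by simp
  qed
  have down: "Bernstein n (Suc j) x \<le> Bernstein n j x" if "t \<le> j" for j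
  proof (cases "j < n")
    case True
    have "(real n - real j) * x \<le> (Suc j) * (1 - x)"
    proof -
      have "(real n + 1) * x \<le> real (Suc j)" using mode that by linarith
      moreover have "real (n - j) = real n - j" using True by simp
      ultimately show ?thesis by (simp add: algebra_simps)
    qed
    then have "Bernstein n j x * ((real n - real j) * x) \<le> Bernstein n j x * ((Suc j) * (1 - x))"
      using x by (intro mult_left_mono Bernstein_nonneg) auto
    then have "Bernstein n (Suc j) x * ((Suc j) * (1 - x)) \<le> Bernstein n j x * ((Suc j) * (1 - x))"
      using Bernstein_Suc_ratio[OF True, of x] by simp
    then show ?thesis using x by simp
  next
    case False
    then have "Bernstein n (Suc j) x = 0" unfolding Bernstein_def by simp
    then show ?thesis using x by (simp add: Bernstein_nonneg)
  qed
  show ?thesis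
  proof (cases "k \<le> t")
    case True
    then show ?thesis
      by (induction k rule: inc_induct) (use up in \<open>auto intro: order_trans\<close>)
  next
    case False
    then have "t \<le> k" by simp
    then show ?thesis
      by (induction k rule: dec_induct) (use down in \<open>auto intro: order_trans\<close>)
  qed
qed

lemma card_nat_near_le:
  fixes m w :: real
  assumes "0 \<le> w"
  shows "real (card {k::nat. \<bar>real k - m\<bar> < w}) \<le> 2 * w + 1"
proof -
  have "int ` {k::nat. \<bar>real k - m\<bar> < w} \<subseteq> {\<lceil>m - w\<rceil>..\<lfloor>m + w\<rfloor>}"
    by (auto simp: ceiling_le_iff le_floor_iff)
  then have "card (int ` {k::nat. \<bar>real k - m\<bar> < w}) \<le> card {\<lceil>m - w\<rceil>..\<lfloor>m + w\<rfloor>}"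
    by (intro card_mono) auto
  then have "card {k::nat. \<bar>real k - m\<bar> < w} \<le> nat (\<lfloor>m + w\<rfloor> + 1 - \<lceil>m - w\<rceil>)"
    by (simp add: card_image)
  moreover have "real_of_int (\<lfloor>m + w\<rfloor> + 1 - \<lceil>m - w\<rceil>) \<le> 2 * w + 1" by linarith
  ultimately show ?thesis using assms by linarith
qed

text \<open>By Chebyshev at least half of the mass lies at integers within
  \<open>w = 2 * sqrt t\<close> of the mean. There are at most
  \<open>2 * w + 1 \<le> 5 * sqrt t\<close> of them, and none carries more mass than the mode
  \<open>t\<close>.\<close>

lemma Bernstein_mode_ge:
  fixes x :: real
  assumes x: "0 < x" "x < 1" and t: "1 \<le> t" "t \<le> n"
    and mode: "t \<le> (n + 1) * x" "(n + 1) * x \<le> t + 1"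
  shows "1 / (10 * sqrt t) \<le> Bernstein n t x"
proof -
  define w where "w = 2 * sqrt t"
  define m where "m = n * x"
  have w: "2 \<le> w" "w\<^sup>2 = 4 * t" unfolding w_def using t by (auto simp: power_mult_distrib)
  have m: "m \<le> 2 * t" "0 \<le> m" unfolding m_def using mode t x by (auto simp: algebra_simps)
  have nn: "0 \<le> Bernstein n k x" for k using x by (simp add: Bernstein_nonneg)
  let ?A = "{k::nat. \<bar>real k - m\<bar> < w}"
  have fin: "finite ?A"
    by (rule finite_subset[of _ "{..nat \<lceil>m + w\<rceil>}"]) (auto, linarith)
  have "1 - m * (1 - x) / w\<^sup>2 = (\<Sum>k\<le>n. Bernstein n k x) - (\<Sum>k\<le>n. (real k - m)\<^sup>2 * Bernstein n k x) / w\<^sup>2"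
    unfolding m_def using sum_Bernstein_variance[of n x] by simp
  also have "\<dots> = (\<Sum>k\<le>n. Bernstein n k x - (real k - m)\<^sup>2 * Bernstein n k x / w\<^sup>2)"
    by (simp only: sum_subtractf sum_divide_distrib)
  \<comment> \<open>Outside \<open>?A\<close> the subtracted quotient is at least the mass itself,
    so the term is not positive.\<close>
  also have "\<dots> \<le> (\<Sum>k\<le>n. if k \<in> ?A then Bernstein n t x else 0)"
  proof (rule sum_mono)
    fix k
    have b: "0 \<le> (real k - m)\<^sup>2 * Bernstein n k x / w\<^sup>2" using nn by simp
    show "Bernstein n k x - (real k - m)\<^sup>2 * Bernstein n k x / w\<^sup>2 \<le> (if k \<in> ?A then Bernstein n t x else 0)"
    proof (cases "k \<in> ?A")
      case True
      then show ?thesis using b Bernstein_le_mode[OF x t(2) mode, of k] by simp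
    next
      case False
      then have "w\<^sup>2 \<le> (real k - m)\<^sup>2"
        using w power_mono[of w "\<bar>real k - m\<bar>" 2] by simp
      then have "w\<^sup>2 * Bernstein n k x \<le> (real k - m)\<^sup>2 * Bernstein n k x"
        using nn by (rule mult_right_mono)
      moreover have "0 < w\<^sup>2" using w t by simp
      ultimately show ?thesis using False by (simp add: pos_le_divide_eq mult.commute)
    qed
  qed
  also have "\<dots> = card ({..n} \<inter> ?A) * Bernstein n t x"
    by (simp add: sum.If_cases Int_def)
  also have "\<dots> \<le> card ?A * Bernstein n t x"
    using fin nn by (intro mult_right_mono) (auto intro!: card_mono)
  also have "\<dots> \<le> (2 * w + 1) * Bernstein n t x"
    using nn card_nat_near_le[of w m] w by (intro mult_right_mono) auto
  also have "\<dots> \<le> 5 * sqrt t * Bernstein n t x"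
    unfolding w_def using nn t by (intro mult_right_mono) auto
  finally have "1 - m * (1 - x) / w\<^sup>2 \<le> 5 * sqrt t * Bernstein n t x" .
  moreover have "m * (1 - x) / w\<^sup>2 \<le> 1 / 2"
  proof -
    have "m * (1 - x) \<le> m * 1" using m x by (intro mult_left_mono) auto
    then show ?thesis using m t by (simp add: w field_simps)
  qed
  ultimately have "1 / 2 \<le> 5 * sqrt t * Bernstein n t x" by linarith
  then show ?thesis using t by (simp add: field_simps)
qed

section \<open>The binomial tail as a function of the success probability\<close>

definition binomial_tail :: "nat \<Rightarrow> nat \<Rightarrow> real \<Rightarrow> real" where
  "binomial_tail n t x = (\<Sum>k\<in>{t<..n}. Bernstein n k x)"

text \<open>Product rule; the absorption identities \<open>c1\<close> and \<open>c2\<close> turn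
  both coefficients into \<open>Suc n\<close> times binomial coefficients of
  \<open>n\<close>.\<close>

lemma Bernstein_deriv:
  assumes "k \<le> n"
  shows "((\<lambda>x. Bernstein (Suc n) (Suc k) x) has_real_derivative
     (Suc n) * (Bernstein n k x - Bernstein n (Suc k) x)) (at x)"
proof -
  have c1: "real (Suc n choose Suc k) * (Suc k) = Suc n * real (n choose k)"
    using arg_cong[OF Suc_times_binomial_eq, of real, of n k]
    by (simp only: of_nat_mult mult.commute)
  have c2: "real (Suc n choose Suc k) * (n - k) = Suc n * real (n choose Suc k)"
    using arg_cong[OF binomial_absorb_comp, of real, of "Suc n" "Suc k"]
    by (simp only: of_nat_mult mult.commute diff_Suc_Suc diff_Suc_1)
  have "((\<lambda>x. Bernstein (Suc n) (Suc k) x) has_real_derivative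
     real (Suc n choose Suc k) * ((Suc k) * x ^ k * (1 - x) ^ (n - k)
       - x ^ Suc k * ((n - k) * (1 - x) ^ (n - k - 1)))) (at x)"
  proof -
    have "((\<lambda>x. (1 - x) ^ (n - k)) has_real_derivative - ((n - k) * (1 - x) ^ (n - k - 1))) (at x)"
      by (auto intro!: derivative_eq_intros)
    note D = DERIV_mult[OF DERIV_cmult[OF DERIV_pow[of "Suc k" x]] this, of "real (Suc n choose Suc k)"]
    show ?thesis
      unfolding Bernstein_def diff_Suc_Suc
      by (rule DERIV_cong[OF D]) (simp only: algebra_simps diff_Suc_Suc diff_zero mult_minus_right diff_conv_add_uminus)
  qed
  also have "real (Suc n choose Suc k) * ((Suc k) * x ^ k * (1 - x) ^ (n - k)
       - x ^ Suc k * ((n - k) * (1 - x) ^ (n - k - 1))) =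
     (real (Suc n choose Suc k) * (Suc k)) * x ^ k * (1 - x) ^ (n - k)
       - (real (Suc n choose Suc k) * (n - k)) * x ^ Suc k * (1 - x) ^ (n - k - 1)"
    by (simp only: right_diff_distrib mult.assoc) (simp only: mult_ac)
  also have "\<dots> = (Suc n) * (Bernstein n k x - Bernstein n (Suc k) x)"
    unfolding c1 c2 Bernstein_def by (simp add: algebra_simps)
  finally show ?thesis .
qed

text \<open>The derivatives of the summands telescope, and a single point mass remains.\<close>

lemma binomial_tail_deriv:
  assumes "t \<le> n"
  shows "(binomial_tail (Suc n) t has_real_derivative (Suc n) * Bernstein n t x) (at x)"
proof -
  have eq: "binomial_tail (Suc n) t = (\<lambda>x. \<Sum>k\<in>{t..<Suc n}. Bernstein (Suc n) (Suc k) x)"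
  proof
    fix x
    have "{t<..Suc n} = Suc ` {t..<Suc n}" by (auto simp: image_Suc_atLeastLessThan)
    then show "binomial_tail (Suc n) t x = (\<Sum>k\<in>{t..<Suc n}. Bernstein (Suc n) (Suc k) x)"
      unfolding binomial_tail_def by (simp only: sum.reindex[OF inj_on_subset[OF inj_Suc subset_UNIV]] o_def)
  qed
  have "((\<lambda>x. \<Sum>k\<in>{t..<Suc n}. Bernstein (Suc n) (Suc k) x) has_real_derivative
     (\<Sum>k\<in>{t..<Suc n}. (Suc n) * (Bernstein n k x - Bernstein n (Suc k) x))) (at x)"
    by (intro DERIV_sum Bernstein_deriv) auto
  also have "(\<Sum>k\<in>{t..<Suc n}. (Suc n) * (Bernstein n k x - Bernstein n (Suc k) x)) =
      (Suc n) * (Bernstein n t x - Bernstein n (Suc n) x)"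
  proof -
    have "(\<Sum>k\<in>{t..<Suc n}. Bernstein n k x - Bernstein n (Suc k) x) = Bernstein n t x - Bernstein n (Suc n) x"
      using assms sum_Suc_diff'[of t "Suc n" "\<lambda>k. - Bernstein n k x"] by simp
    then show ?thesis unfolding sum_distrib_left[symmetric] by (rule arg_cong)
  qed
  also have "Bernstein n (Suc n) x = 0" unfolding Bernstein_def by simp
  finally show ?thesis unfolding eq by simp
qed

lemma binomial_tail_mono:
  fixes x y :: real
  assumes "t \<le> n" "0 \<le> x" "x \<le> y" "y \<le> 1"
  shows "binomial_tail (Suc n) t x \<le> binomial_tail (Suc n) t y"
  using assms
  by (intro DERIV_nonneg_imp_nondecreasing[OF assms(3)])
     (auto intro!: binomial_tail_deriv mult_nonneg_nonneg Bernstein_nonneg exI)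

text \<open>Mean value theorem. At the intermediate point \<open>v\<close> the derivative is
  \<open>Suc n\<close> times the mass at \<open>t\<close>, and \<open>t\<close> is a mode there
  because \<open>t \<le> (n + 1) * v \<le> t + 1\<close>.\<close>

lemma binomial_tail_growth:
  fixes x y :: real
  assumes t: "1 \<le> t" "t \<le> n" and x: "t \<le> (Suc n) * x" and xy: "x < y" and y: "y \<le> 1" "(Suc n) * y \<le> t + 1"
  shows "(Suc n) * (y - x) / (10 * sqrt t) \<le> binomial_tail (Suc n) t y - binomial_tail (Suc n) t x"
proof -
  obtain v where v: "x < v" "v < y"
    "binomial_tail (Suc n) t y - binomial_tail (Suc n) t x = (y - x) * ((Suc n) * Bernstein n t v)"
    using MVT2[OF xy binomial_tail_deriv[OF t(2)]] by metis
  have "0 < (Suc n) * x" using t x by linarith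
  then have "0 < x" by (simp add: zero_less_mult_iff)
  moreover have "t \<le> (real n + 1) * v"
    using order_trans[OF x mult_left_mono[of x v]] v by (simp add: add.commute)
  moreover have "(real n + 1) * v \<le> t + 1"
    using order_trans[OF mult_left_mono[of v y] y(2)] v by (simp add: add.commute)
  ultimately have "1 / (10 * sqrt t) \<le> Bernstein n t v"
    using t x y v by (intro Bernstein_mode_ge) auto
  then have "((y - x) * Suc n) * (1 / (10 * sqrt t)) \<le> ((y - x) * Suc n) * Bernstein n t v"
    using xy by (intro mult_left_mono) auto
  then show ?thesis unfolding v(3) by (simp add: mult_ac)
qed

text \<open>Membership in \<open>S\<close> turns the sample into independent Bernoulli trials, so
  the number of hits is binomial.\<close>

lemma prob_hits_greater_eq:
  "measure_pmf.prob (replicate_pmf n p) {xs. t < hits S xs} = binomial_tail n t (measure_pmf.prob p S)"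
proof -
  let ?h = "measure_pmf.prob p S"
  have h: "?h \<in> {0..1}" by simp
  have rep: "map_pmf (map f) (replicate_pmf n p) = replicate_pmf n (map_pmf f p)" for f :: "'a \<Rightarrow> bool"
  proof (induction n)
    case (Suc n)
    show ?case by (simp add: map_bind_pmf bind_map_pmf flip: Suc)
  qed simp
  have bern: "map_pmf (\<lambda>x. x \<in> S) p = bernoulli_pmf ?h"
  proof (rule pmf_eqI)
    fix b
    show "pmf (map_pmf (\<lambda>x. x \<in> S) p) b = pmf (bernoulli_pmf ?h) b"
      using measure_pmf.prob_compl[of S p]
      by (cases b) (auto simp: pmf_map vimage_def Compl_eq_Diff_UNIV[symmetric] Collect_neg_eq)
  qed
  have "measure_pmf.prob (replicate_pmf n p) {xs. t < hits S xs} =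
    measure_pmf.prob (map_pmf (hits S) (replicate_pmf n p)) {t<..}"
    by (simp add: vimage_def)
  also have "map_pmf (hits S) (replicate_pmf n p) = binomial_pmf n ?h"
    unfolding binomial_pmf_altdef[OF h] bern[symmetric] rep[symmetric]
    by (simp add: pmf.map_comp o_def hits_def[abs_def] filter_map)
  also have "measure_pmf.prob (binomial_pmf n ?h) {t<..} = measure_pmf.prob (binomial_pmf n ?h) {t<..n}"
    by (intro measure_prob_cong_0) auto
  also have "\<dots> = (\<Sum>k\<in>{t<..n}. pmf (binomial_pmf n ?h) k)"
    by (rule measure_measure_pmf_finite) simp
  also have "\<dots> = binomial_tail n t ?h"
    unfolding binomial_tail_def Bernstein_def using h by (simp add: mult_ac)
  finally show ?thesis .
qed

text \<open>Used with \<open>g = \<gamma> * n''\<close> and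
  \<open>a = \<delta> / (5 * \<gamma>)\<close>, so that \<open>t\<close> is \<open>t''\<close> and
  \<open>g * (1 + 5 * a)\<close> is the mean number of hits of a set of mass
  \<open>\<gamma> + \<delta>\<close>. The gap is \<open>m - t = g * a * (3 - a)\<close>, and
  \<open>a < 1 / 15\<close> makes its square at least \<open>25 / 4 * a^2 * g * m\<close>.\<close>

lemma prob_hits_greater_large:
  fixes a g :: real
  assumes fin: "finite (set_pmf p)" and a: "0 < a" "a < 1 / 15" and g: "0 < g"
    and t: "real t = (1 + a)\<^sup>2 * g" and H: "g * (1 + 5 * a) \<le> N * measure_pmf.prob p H"
  shows "a\<^sup>2 * g / (a\<^sup>2 * g + 4 / 25) \<le> measure_pmf.prob (replicate_pmf N p) {xs. t < hits H xs}"
proof -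
  define m where "m = g * (1 + 5 * a)"
  have d: "m - t = g * (a * (3 - a))"
    unfolding m_def t by (simp add: power2_eq_square algebra_simps)
  have pos: "0 < g * (a * (3 - a))" using a g by simp
  have m0: "0 < m" unfolding m_def using a g by simp
  have "(1 + 5 * a) * (25 / 4) \<le> (3 - 1 / 15)\<^sup>2"
    using a by (simp add: power2_eq_square)
  also have "\<dots> \<le> (3 - a)\<^sup>2" using a by (intro power_mono) auto
  finally have "(g * a)\<^sup>2 * (1 + 5 * a) \<le> (g * a)\<^sup>2 * ((3 - a)\<^sup>2 * (4 / 25))"
    by (intro mult_left_mono) auto
  then have "a\<^sup>2 * g * m \<le> (m - t)\<^sup>2 * (4 / 25)"
    unfolding d unfolding m_def by (simp add: power2_eq_square mult_ac)
  moreover have "0 < a\<^sup>2 * g + 4 / 25" using a g by (intro add_nonneg_pos) auto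
  ultimately have "a\<^sup>2 * g / (a\<^sup>2 * g + 4 / 25) \<le> (m - t)\<^sup>2 / ((m - t)\<^sup>2 + m)"
    using m0 by (intro ratio_add_mono) (auto intro!: add_nonneg_pos)
  also have "\<dots> \<le> measure_pmf.prob (replicate_pmf N p) {xs. t < hits H xs}"
    using pos d H unfolding m_def by (intro prob_hits_greater_ge[OF fin]) auto
  finally show ?thesis .
qed

text \<open>The gap is now \<open>t - m = g * a * (1 + a)\<close>, whose square is at least
  \<open>a^2 * g * m\<close>.\<close>

lemma prob_hits_le_large:
  fixes a g :: real
  assumes fin: "finite (set_pmf p)" and a: "0 < a" and g: "0 < g"
    and t: "real t = (1 + a)\<^sup>2 * g" and F: "N * measure_pmf.prob p F \<le> g * (1 + a)"
  shows "a\<^sup>2 * g / (a\<^sup>2 * g + 1) \<le> measure_pmf.prob (replicate_pmf N p) {xs. hits F xs \<le> t}"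
proof -
  define m where "m = g * (1 + a)"
  have d: "t - m = g * (a * (1 + a))"
    unfolding m_def t by (simp add: power2_eq_square algebra_simps)
  have pos: "0 < g * (a * (1 + a))" using a g by simp
  have m0: "0 < m" unfolding m_def using a g by simp
  have "(g * a)\<^sup>2 * (1 + a) \<le> (g * a)\<^sup>2 * (1 + a)\<^sup>2"
    using a by (intro mult_left_mono) (auto simp: power2_eq_square)
  then have "a\<^sup>2 * g * m \<le> (t - m)\<^sup>2 * 1"
    unfolding d unfolding m_def by (simp add: power2_eq_square mult_ac)
  moreover have "0 < a\<^sup>2 * g + 1" using a g by (intro add_nonneg_pos) auto
  ultimately have "a\<^sup>2 * g / (a\<^sup>2 * g + 1) \<le> (t - m)\<^sup>2 / ((t - m)\<^sup>2 + m)"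
    using m0 by (intro ratio_add_mono) (auto intro!: add_nonneg_pos)
  also have "\<dots> \<le> measure_pmf.prob (replicate_pmf N p) {xs. hits F xs \<le> t}"
    using pos d F unfolding m_def by (intro prob_hits_le_ge[OF fin]) auto
  finally show ?thesis .
qed

text \<open>In the application \<open>e\<close> is \<open>1 - \<eta>\<^sub>2\<close>. For
  \<open>Y \<ge> 4\<close> the tail bound is at least 12/13. For smaller \<open>Y\<close> it may be
  poor, but it is at least \<open>Y / 13\<close>, while \<open>e\<close> is at most a tiny multiple
  of \<open>Y\<close>.\<close>

lemma prob_hits_greater:
  fixes a g e :: real
  assumes fin: "finite (set_pmf p)" and a: "0 < a" "a < 1 / 15" and g: "0 < g"
    and t: "real t = (1 + a)\<^sup>2 * g" and H: "g * (1 + 5 * a) \<le> N * measure_pmf.prob p H"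
    and e: "e \<le> 1" "e \<le> a\<^sup>2 * g / 40000000"
  shows "12 / 13 * e \<le> measure_pmf.prob (replicate_pmf N p) {xs. t < hits H xs}"
proof -
  define Y where "Y = a\<^sup>2 * g"
  have Y: "0 < Y" unfolding Y_def using a g by simp
  have "12 / 13 * e \<le> Y / (Y + 4 / 25)"
  proof (cases "4 \<le> Y")
    case True
    then have "12 / 13 \<le> Y / (Y + 4 / 25)" by (simp add: field_simps)
    then show ?thesis using e by linarith
  next
    case False
    have "Y * (1 / 13) \<le> Y / (Y + 4 / 25)" using False Y by (simp add: field_simps)
    then show ?thesis using e Y unfolding Y_def[symmetric] by linarith
  qed
  then show ?thesis
    using prob_hits_greater_large[OF fin a g t H] unfolding Y_def by linarith
qed

lemma prob_hits_le:
  fixes a g e :: real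
  assumes fin: "finite (set_pmf p)" and a: "0 < a" "a < 1 / 15" and g: "0 < g"
    and t: "real t = (1 + a)\<^sup>2 * g" and F: "N * measure_pmf.prob p F \<le> g * (1 + a)"
    and e: "0 \<le> e" "e \<le> 1" "e \<le> a\<^sup>2 * g / 40000000"
  shows "e * (a / (3 * (1 + a))) \<le> measure_pmf.prob (replicate_pmf N p) {xs. hits F xs \<le> t}"
proof -
  define Y where "Y = a\<^sup>2 * g"
  have Y: "0 < Y" unfolding Y_def using a g by simp
  have "a / (3 * (1 + a)) \<le> 1 / 3" using a by (simp add: field_simps)
  then have "e * (a / (3 * (1 + a))) \<le> e * (1 / 3)" using e by (intro mult_left_mono)
  also have "\<dots> \<le> Y / (Y + 1)"
  proof (cases "1 \<le> Y")
    case True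
    then have "1 / 3 \<le> Y / (Y + 1)" by (simp add: field_simps)
    then show ?thesis using e by linarith
  next
    case False
    then have "Y * (1 / 3) \<le> Y / (Y + 1)" using Y by (simp add: field_simps)
    then show ?thesis using e Y unfolding Y_def[symmetric] by linarith
  qed
  finally show ?thesis
    using prob_hits_le_large[OF fin a(1) g t F] unfolding Y_def by linarith
qed

text \<open>For \<open>Y \<ge> 4\<close> subtracting the failure probability of one event from the
  probability of the other leaves at least 1/2. For \<open>Y < 4\<close> the separate bounds are too
  weak; the increment of the binomial tail is at least \<open>a / 30\<close>, and \<open>e\<close>
  is below 1/30.\<close>

lemma prob_hits_between:
  fixes a g e :: real
  assumes fin: "finite (set_pmf p)" and a: "0 < a" "a < 1 / 15" and g: "0 < g"
    and t: "real t = (1 + a)\<^sup>2 * g" and N: "g * (1 + 5 * a) \<le> N" and sub: "F \<subseteq> H"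
    and F: "N * measure_pmf.prob p F \<le> g * (1 + a)" and H: "g * (1 + 5 * a) \<le> N * measure_pmf.prob p H"
    and e: "0 \<le> e" "e \<le> 1" "e \<le> a\<^sup>2 * g / 40000000"
  shows "e * (a / (3 * (1 + a))) \<le> measure_pmf.prob (replicate_pmf N p) {xs. hits F xs \<le> t \<and> t < hits H xs}"
proof -
  let ?pr = "measure_pmf.prob (replicate_pmf N p)"
  define Y where "Y = a\<^sup>2 * g"
  have Y: "0 < Y" unfolding Y_def using a g by simp
  have a3: "a / (3 * (1 + a)) \<le> a" using a by (simp add: field_simps)
  have ea: "e * (a / (3 * (1 + a))) \<le> e * a"
    using e a3 by (intro mult_left_mono) auto
  have sp: "?pr {xs. hits F xs \<le> t \<and> t < hits H xs} = ?pr {xs. t < hits H xs} - ?pr {xs. t < hits F xs}"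
  proof -
    have "{xs. hits F xs \<le> t \<and> t < hits H xs} = {xs. t < hits H xs} - {xs. t < hits F xs}"
      by auto
    moreover have "{xs. t < hits F xs} \<subseteq> {xs. t < hits H xs}"
      using hits_mono[OF sub] by (auto intro: less_le_trans)
    ultimately show ?thesis by (simp add: measure_pmf.finite_measure_Diff)
  qed
  show ?thesis
  proof (cases "4 \<le> Y")
    case True
    have "{xs. t < hits F xs} = UNIV - {xs. hits F xs \<le> t}" by auto
    then have "?pr {xs. t < hits F xs} = 1 - ?pr {xs. hits F xs \<le> t}"
      using measure_pmf.prob_compl[of "{xs. hits F xs \<le> t}" "replicate_pmf N p"] by simp
    moreover have "4 / 5 \<le> Y / (Y + 1)" "3 / 4 \<le> Y / (Y + 4 / 25)"
      using True by (simp_all add: field_simps)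
    ultimately have "1 / 2 \<le> ?pr {xs. hits F xs \<le> t \<and> t < hits H xs}"
      using prob_hits_greater_large[OF fin a g t H] prob_hits_le_large[OF fin a(1) g t F] sp
      unfolding Y_def by linarith
    moreover have "e * a \<le> 1 * (1 / 2)" using e a by (intro mult_mono) auto
    ultimately show ?thesis using ea by linarith
  next
    case False
    \<comment> \<open>The events \<open>t < hits H\<close> and \<open>t < hits F\<close> are nested, so the probability is an increment of
      the binomial tail in the success probability. Its derivative is a binomial point mass,
      which for arguments between \<open>t / N\<close> and \<open>(t + 1) / N\<close> is the mode.\<close>
    have "0 < g * (1 + 5 * a)" using g a by simp
    then have N0: "0 < N" using N by (cases N) auto
    then obtain n where n: "N = Suc n" using gr0_implies_Suc by blast
    have gap: "g * (1 + 5 * a) - t = g * (a * (3 - a))"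
      unfolding t by (simp add: power2_eq_square algebra_simps)
    have pos: "0 < g * (a * (3 - a))" using a g by simp
    have "0 < real t" unfolding t using a g by simp
    then have t1: "1 \<le> t" by simp
    have "real t < N" using gap pos N by linarith
    then have tn: "t \<le> n" unfolding n by simp
    define f h where "f = measure_pmf.prob p F" and "h = measure_pmf.prob p H"
    \<comment> \<open>The interval from \<open>x\<close> to \<open>y\<close> lies between the masses
      of \<open>F\<close> and \<open>H\<close>. The cap at \<open>t + 1\<close> keeps
      \<open>t\<close> a mode throughout.\<close>
    define x y where "x = t / N" and "y = min (g * (1 + 5 * a)) (t + 1) / N"
    have Nx: "N * x = t" unfolding x_def using N0 by simp
    have Ny: "N * y = min (g * (1 + 5 * a)) (t + 1)"
      unfolding y_def using N0 by simp
    have "g * (1 + a) \<le> t" unfolding t using a g by (simp add: power2_eq_square algebra_simps)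
    then have "N * f \<le> N * x" using F unfolding Nx f_def by linarith
    then have fx: "f \<le> x" using N0 by simp
    have "N * y \<le> N * h" using H unfolding Ny h_def by linarith
    then have yh: "y \<le> h" using N0 by simp
    have "N * x < N * y" unfolding Nx Ny using gap pos by simp
    then have xy: "x < y" using N0 by simp
    have h1: "h \<le> 1" and f0: "0 \<le> f" unfolding h_def f_def by auto
    have "N * (y - x) / (10 * sqrt t) \<le> binomial_tail N t y - binomial_tail N t x"
      unfolding n using t1 tn xy yh h1 Nx Ny unfolding n
      by (intro binomial_tail_growth) auto
    also have "\<dots> \<le> binomial_tail N t h - binomial_tail N t f"
      unfolding n using tn fx yh h1 f0 xy
      by (intro diff_mono binomial_tail_mono) auto
    also have "\<dots> = ?pr {xs. hits F xs \<le> t \<and> t < hits H xs}"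
      unfolding sp prob_hits_greater_eq f_def h_def by simp
    finally have main: "N * (y - x) / (10 * sqrt t) \<le> ?pr {xs. hits F xs \<le> t \<and> t < hits H xs}" .
    define w where "w = sqrt t"
    have w: "1 \<le> w" "w\<^sup>2 = t" unfolding w_def using t1 by auto
    have "(1 + a)\<^sup>2 \<le> (1 + 1 / 15)\<^sup>2" using a by (intro power_mono) auto
    then have a2: "(1 + a)\<^sup>2 \<le> 2" by (simp add: power2_eq_square)
    have "(a * w)\<^sup>2 = (1 + a)\<^sup>2 * Y" unfolding power_mult_distrib w t Y_def by (simp add: mult_ac)
    also have "\<dots> \<le> 2 * 4" using a2 False Y by (intro mult_mono) auto
    also have "\<dots> \<le> 3\<^sup>2" by simp
    finally have aw: "a * w \<le> 3" by (rule power2_le_imp_le) simp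
    have "N * (y - x) = min (g * (a * (3 - a))) 1"
      using gap Nx Ny by (simp add: right_diff_distrib min_def)
    moreover have "a * w \<le> g * (a * (3 - a))"
    proof -
      have "w \<le> w\<^sup>2" using w(1) by (simp add: power2_eq_square)
      also have "\<dots> \<le> 2 * g" unfolding w t using a2 g by (intro mult_right_mono) auto
      also have "\<dots> \<le> (3 - a) * g" using a g by (intro mult_right_mono) auto
      finally have "a * w \<le> a * ((3 - a) * g)" using a by (intro mult_left_mono) auto
      then show ?thesis by (simp add: mult_ac)
    qed
    \<comment> \<open>Since \<open>a * w \<le> 3\<close>, this minimum is at least
      \<open>a * w / 3\<close>; the factor \<open>w = sqrt t\<close> then cancels against the root
      in the bound for the mode.\<close>
    ultimately have "min (a * w) 1 \<le> N * (y - x)" by linarith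
    moreover have "a * w / 3 \<le> min (a * w) 1"
      using aw a w by (auto simp: min_def)
    ultimately have "a * w / 3 / (10 * w) \<le> N * (y - x) / (10 * w)"
      using w by (intro divide_right_mono) auto
    also have "\<dots> \<le> ?pr {xs. hits F xs \<le> t \<and> t < hits H xs}"
      using main unfolding w_def .
    also have "a * w / 3 / (10 * w) = a / 30" using w by simp
    finally have "a / 30 \<le> ?pr {xs. hits F xs \<le> t \<and> t < hits H xs}" .
    moreover have "e * a \<le> 1 / 30 * a"
      using e False a unfolding Y_def[symmetric] by (intro mult_right_mono) auto
    ultimately show ?thesis using ea by linarith
  qed
qed

subsection \<open>Selecting far points\<close>

text \<open>Here \<open>m\<close> counts the selected points lying in \<open>G\<close>. It is minorized by a quadratic polynomial in
  the numbers of hits of \<open>G\<close> and \<open>O'\<close>: of Chebyshev type for large \<open>x\<close>, of Cauchy-Schwarz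
  type for small \<open>x\<close>.\<close>

lemma expectation_selected_ge:
  fixes m :: "'a list \<Rightarrow> real" and x w e :: real
  assumes fin: "finite (set_pmf p)" and disj: "G \<inter> O' = {}"
    and x: "0 < x" "x \<le> k * measure_pmf.prob p G" and w: "w = k * measure_pmf.prob p O'" "15 * x \<le> w"
    and t: "real t = 3 / 2 * (w + x)"
    and m: "\<And>xs. xs \<in> set_pmf (replicate_pmf k p) \<Longrightarrow> 0 \<le> m xs"
      "\<And>xs. xs \<in> set_pmf (replicate_pmf k p) \<Longrightarrow> hits G xs \<le> m xs \<or> t \<le> m xs + hits O' xs"
    and e: "0 \<le> e" "e \<le> 1" "e \<le> x / 200000000"
  shows "13 / 24 * e * x \<le> measure_pmf.expectation (replicate_pmf k p) m"
proof -
  let ?M = "replicate_pmf k p"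
  note int = integrable_measure_pmf_finite[OF finite_set_replicate_pmf[OF fin]]
  define X where "X = k * measure_pmf.prob p G"
  have X: "x \<le> X" "0 < X" using x unfolding X_def by auto
  have w0: "0 < w" using w x by linarith
  show ?thesis
  proof (cases "1000 \<le> x")
    case True
    \<comment> \<open>If \<open>m\<close> is below \<open>9 / 10 * x\<close>, then \<open>G\<close>
      has at least \<open>X / 10\<close> hits too few or \<open>O'\<close> at least
      \<open>w / 2\<close> hits too many. Either makes one of the scaled squares at least 1, so the
      polynomial is not positive.\<close>
    let ?Q = "\<lambda>xs. 9 / 10 * x * (1 - 100 / X\<^sup>2 * (real (hits G xs) - X)\<^sup>2 - 4 / w\<^sup>2 * (real (hits O' xs) - w)\<^sup>2)"
    have "9 / 10 * x * (1 - 1 / 10 - 1 / 10) \<le> 9 / 10 * x * (1 - 100 / X\<^sup>2 * X - 4 / w\<^sup>2 * w)"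
      using True X w x by (intro mult_left_mono diff_mono) (auto simp: power2_eq_square field_simps)
    also have "\<dots> \<le> 9 / 10 * x * (1 - 100 / X\<^sup>2 * measure_pmf.expectation ?M (\<lambda>xs. (real (hits G xs) - X)\<^sup>2)
        - 4 / w\<^sup>2 * measure_pmf.expectation ?M (\<lambda>xs. (real (hits O' xs) - w)\<^sup>2))"
      using x variance_hits_le[OF fin, of k G] variance_hits_le[OF fin, of k O']
      unfolding X_def[symmetric] w(1)[symmetric]
      by (intro mult_left_mono diff_mono) auto
    also have "\<dots> = measure_pmf.expectation ?M ?Q"
      by (simp add: int)
    also have "\<dots> \<le> measure_pmf.expectation ?M m"
    proof (rule integral_mono_AE[OF int int], unfold AE_measure_pmf_iff, rule ballI)
      fix xs assume xs: "xs \<in> set_pmf ?M"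
      let ?b = "1 - 100 / X\<^sup>2 * (real (hits G xs) - X)\<^sup>2 - 4 / w\<^sup>2 * (real (hits O' xs) - w)\<^sup>2"
      have sq: "0 \<le> 100 / X\<^sup>2 * (real (hits G xs) - X)\<^sup>2" "0 \<le> 4 / w\<^sup>2 * (real (hits O' xs) - w)\<^sup>2"
        by auto
      show "9 / 10 * x * ?b \<le> m xs"
      proof (cases "9 / 10 * x \<le> m xs")
        case True
        have "?b \<le> 1" using sq by linarith
        then have "9 / 10 * x * ?b \<le> 9 / 10 * x * 1" using x by (intro mult_left_mono) auto
        then show ?thesis using True by linarith
      next
        case False
        have "?b \<le> 0"
          using m(2)[OF xs]
        proof
          assume "hits G xs \<le> m xs"
          then have "X / 10 \<le> X - hits G xs" using False X by linarith
          then have "(X / 10)\<^sup>2 \<le> (X - hits G xs)\<^sup>2" using X by (intro power_mono) auto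
          then have "1 \<le> 100 / X\<^sup>2 * (real (hits G xs) - X)\<^sup>2"
            using X by (simp add: power2_commute field_simps)
          then show ?thesis using sq by linarith
        next
          assume "t \<le> m xs + hits O' xs"
          then have "w / 2 \<le> hits O' xs - w" using False x(1) t by (simp add: field_simps)
          then have "(w / 2)\<^sup>2 \<le> (hits O' xs - w)\<^sup>2" using w0 by (intro power_mono) auto
          then have "1 \<le> 4 / w\<^sup>2 * (real (hits O' xs) - w)\<^sup>2"
            using w0 by (simp add: field_simps)
          then show ?thesis using sq by linarith
        qed
        then have "9 / 10 * x * ?b \<le> 0" using x by (simp add: mult_nonneg_nonpos)
        then show ?thesis using m(1)[OF xs] by linarith
      qed
    qed
    finally have "18 / 25 * x \<le> measure_pmf.expectation ?M m" by simp
    moreover have "13 / 24 * e * x \<le> 18 / 25 * x" using e x by (intro mult_right_mono) auto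
    ultimately show ?thesis by linarith
  next
    case False
    \<comment> \<open>This value maximizes \<open>2 / 3 * l * X - l^2 * (X * (1 + X))\<close>, the
      lower bound obtained below for the expectation of \<open>?Q\<close>.\<close>
    define l where "l = 1 / (3 * (1 + X))"
    have l: "0 < l" unfolding l_def using X by simp
    have t0: "0 < real t" unfolding t using x w0 by simp
    \<comment> \<open>With \<open>b\<close> hits of \<open>G\<close>,
      \<open>2 * l * b - l^2 * b^2 \<le> 1\<close> by completing the square. The mixed term makes
      \<open>?Q\<close> nonpositive once \<open>O'\<close> has \<open>t\<close> hits; if
      \<open>b > 0\<close> and \<open>O'\<close> has fewer, integrality gives
      \<open>m \<ge> 1\<close>.\<close>
    let ?Q = "\<lambda>xs. 2 * l * real (hits G xs) - 2 * l / t * (real (hits G xs) * real (hits O' xs))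
        - l\<^sup>2 * (real (hits G xs) * real (hits G xs))"
    have "x / (9 * 1001) \<le> x / (9 * (1 + x))" using False x by (intro divide_left_mono) auto
    also have "\<dots> \<le> X / (9 * (1 + X))" using X x by (simp add: field_simps)
    also have "\<dots> = 2 * l * X - 4 / 3 * l * X - l\<^sup>2 * (X * (1 + X))"
    proof -
      have "l\<^sup>2 * (X * (1 + X)) = l * X * (l * (1 + X))" by (simp add: power2_eq_square mult_ac)
      also have "l * (1 + X) = 1 / 3" unfolding l_def using X by simp
      finally have "l\<^sup>2 * (X * (1 + X)) = l * X * (1 / 3)" .
      moreover have "X / (9 * (1 + X)) = l * X * (1 / 3)" unfolding l_def by simp
      ultimately show ?thesis by linarith
    qed
    also have "\<dots> \<le> measure_pmf.expectation ?M ?Q"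
    proof -
      let ?h = "measure_pmf.prob p G" and ?o = "measure_pmf.prob p O'"
      have "measure_pmf.expectation ?M ?Q =
          2 * l * X - 2 * l / t * (real k * (real k - 1) * (?h * ?o)) - l\<^sup>2 * (X + real k * (real k - 1) * (?h * ?h))"
        using disj by (simp add: int expectation_hits[OF fin] expectation_hits_mult[OF fin] X_def)
      moreover have "2 * l / t * (real k * (real k - 1) * (?h * ?o)) \<le> 4 / 3 * l * X"
      proof -
        have "real k * (real k - 1) * (?h * ?o) \<le> real k * real k * (?h * ?o)"
          by (intro mult_right_mono mult_left_mono) auto
        also have "\<dots> = X * w" unfolding X_def w by simp
        finally have "2 * l / t * (real k * (real k - 1) * (?h * ?o)) \<le> 2 * l / t * (X * w)"
          using l by (intro mult_left_mono) auto
        also have "\<dots> = (2 * l * X) * (w / t)" by simp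
        also have "\<dots> \<le> (2 * l * X) * (2 / 3)"
        proof (intro mult_left_mono)
          show "w / t \<le> 2 / 3" using t0 t x by (simp add: pos_divide_le_eq)
        qed (use l X in auto)
        finally show ?thesis by simp
      qed
      moreover have "l\<^sup>2 * (X + real k * (real k - 1) * (?h * ?h)) \<le> l\<^sup>2 * (X * (1 + X))"
      proof (intro mult_left_mono)
        have "real k * (real k - 1) * (?h * ?h) \<le> real k * real k * (?h * ?h)"
          by (intro mult_right_mono mult_left_mono) auto
        then show "X + real k * (real k - 1) * (?h * ?h) \<le> X * (1 + X)"
          unfolding X_def by (simp add: algebra_simps)
      qed auto
      ultimately show ?thesis by linarith
    qed
    also have "\<dots> \<le> measure_pmf.expectation ?M m"
    proof (rule integral_mono_AE[OF int int], unfold AE_measure_pmf_iff, rule ballI)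
      fix xs assume xs: "xs \<in> set_pmf ?M"
      define b c where "b = hits G xs" and "c = hits O' xs"
      have sq: "2 * l * b - l\<^sup>2 * (real b * real b) \<le> 1"
      proof -
        have "0 \<le> (1 - l * b)\<^sup>2" by simp
        then show ?thesis by (simp add: power2_eq_square algebra_simps)
      qed
      have "2 * l * b - 2 * l / t * (real b * real c) - l\<^sup>2 * (real b * real b) \<le> m xs"
      proof (cases "b = 0 \<or> t \<le> c")
        case True
        have "2 * l * b - 2 * l / t * (real b * real c) = (2 * l * b) * (1 - c / t)"
          by (simp add: algebra_simps)
        also have "\<dots> \<le> 0"
        proof (cases "b = 0")
          case False
          then have "1 - c / t \<le> 0" using True t0 by simp
          then show ?thesis using l by (intro mult_nonneg_nonpos) auto
        qed simp
        finally have "2 * l * b - 2 * l / t * (real b * real c) \<le> 0" .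
        moreover have "0 \<le> l\<^sup>2 * (real b * real b)" by simp
        ultimately show ?thesis using m(1)[OF xs] by linarith
      next
        case False
        then have "1 \<le> m xs" using m(2)[OF xs] unfolding b_def c_def by auto
        moreover have "0 \<le> 2 * l / t * (real b * real c)" using l by simp
        ultimately show ?thesis using sq by linarith
      qed
      then show "?Q xs \<le> m xs" unfolding b_def c_def .
    qed
    finally have "x / 9009 \<le> measure_pmf.expectation ?M m" by simp
    moreover have "13 / 24 * e * x \<le> 1 / 9009 * x"
      using e x False by (intro mult_right_mono) auto
    ultimately show ?thesis by simp
  qed
qed

text \<open>If a sampled point of \<open>G\<close> is left out, the selection has exactly
  \<open>t\<close> points, all of them farther than \<open>r\<close>, so each lies in
  \<open>G\<close> or outside \<open>U\<close>. Otherwise every sampled point of \<open>G\<close> is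
  selected.\<close>

lemma farthest_points_selected:
  assumes far: "farthest_points t c xs Q" and xs: "set xs \<subseteq> P"
    and G: "G = {x \<in> U. r < dist x c}"
  shows "hits G xs \<le> size (filter_mset (\<lambda>x. x \<in> G) Q) \<or>
         t \<le> size (filter_mset (\<lambda>x. x \<in> G) Q) + hits (P - U) xs"
proof -
  have sub: "Q \<subseteq># mset xs" and sz: "size Q = min t (length xs)"
    and far': "\<And>x y. x \<in># Q \<Longrightarrow> y \<in># mset xs - Q \<Longrightarrow> dist y c \<le> dist x c"
    using far unfolding farthest_points_def by auto
  have hits: "hits S xs = size (filter_mset (\<lambda>x. x \<in> S) (mset xs))" for S
    unfolding hits_def by (metis mset_filter size_mset)
  show ?thesis
  proof (cases "\<exists>y. y \<in># mset xs - Q \<and> y \<in> G")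
    case True
    then obtain y where y: "y \<in># mset xs - Q" "y \<in> G" by blast
    then have "Q \<noteq> mset xs" by auto
    then have "size Q \<noteq> length xs"
      using sub by (metis mset_subset_size nless_le size_mset subset_mset.le_imp_less_or_eq)
    then have "size Q = t" using sz by auto
    moreover have "x \<in> G \<longleftrightarrow> \<not> x \<in> P - U" if "x \<in># Q" for x
    proof -
      have "r < dist x c" using far'[OF that y(1)] y(2) unfolding G by auto
      moreover have "x \<in> P" using mset_subset_eqD[OF sub that] xs by auto
      ultimately show ?thesis unfolding G by auto
    qed
    then have "filter_mset (\<lambda>x. x \<in> G) Q = filter_mset (\<lambda>x. \<not> x \<in> P - U) Q"
      by (intro filter_mset_cong) auto
    then have "size Q = size (filter_mset (\<lambda>x. x \<in> G) Q) + size (filter_mset (\<lambda>x. x \<in> P - U) Q)"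
      by (metis add.commute multiset_partition size_union)
    moreover have "size (filter_mset (\<lambda>x. x \<in> P - U) Q) \<le> hits (P - U) xs"
      unfolding hits by (intro size_mset_mono multiset_filter_mono sub)
    ultimately show ?thesis by linarith
  next
    case False
    then have "filter_mset (\<lambda>x. x \<in> G) (mset xs - Q) = {#}"
      unfolding filter_mset_eq_mempty_iff by blast
    then have "filter_mset (\<lambda>x. x \<in> G) (mset xs) = filter_mset (\<lambda>x. x \<in> G) Q"
      using sub by (metis add.right_neutral filter_union_mset subset_mset.add_diff_inverse)
    then show ?thesis unfolding hits by simp
  qed
qed

lemma prob_pmf_of_multiset:
  assumes "M \<noteq> {#}"
  shows "measure_pmf.prob (pmf_of_multiset M) S = size (filter_mset (\<lambda>x. x \<in> S) M) / size M"
proof -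
  have "measure_pmf.prob (pmf_of_multiset M) S = measure_pmf.prob (pmf_of_multiset M) (S \<inter> set_mset M)"
    using measure_Int_set_pmf[of "pmf_of_multiset M" S] assms by simp
  also have "\<dots> = (\<Sum>x\<in>S \<inter> set_mset M. count M x / size M)"
    using assms by (simp add: measure_measure_pmf_finite)
  also have "\<dots> = real (\<Sum>x\<in>S \<inter> set_mset M. count M x) / size M"
    by (simp add: sum_divide_distrib)
  also have "(\<Sum>x\<in>S \<inter> set_mset M. count M x) = size (filter_mset (\<lambda>x. x \<in> S) M)"
    by (auto simp: size_multiset_overloaded_eq intro!: sum.cong)
  finally show ?thesis .
qed

lemma prob_mono_set_pmf:
  assumes "\<And>x. x \<in> set_pmf p \<Longrightarrow> x \<in> A \<Longrightarrow> x \<in> B"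
  shows "measure_pmf.prob p A \<le> measure_pmf.prob p B"
proof -
  have "measure_pmf.prob p (A \<inter> set_pmf p) \<le> measure_pmf.prob p B"
    using assms by (intro measure_pmf.finite_measure_mono) auto
  then show ?thesis by (simp add: measure_Int_set_pmf)
qed

text \<open>Ranks are counted by strictly farther points, so that ties enlarge the set.\<close>

definition farthest_ranked :: "'a::metric_space set \<Rightarrow> real \<Rightarrow> 'a \<Rightarrow> 'a set" where
  "farthest_ranked P \<kappa> c = {x \<in> P. real (card {y \<in> P. dist x c < dist y c}) \<le> \<kappa>}"

text \<open>Let \<open>y\<close> be a farthest point outside the ranked set. All points strictly
  farther than \<open>y\<close> are ranked, and there are more than \<open>\<kappa>\<close> of them
  because \<open>y\<close> is not.\<close>

lemma card_farthest_ranked_ge: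
  fixes \<kappa> :: real
  assumes "finite P" "\<kappa> \<le> card P"
  shows "\<kappa> \<le> card (farthest_ranked P \<kappa> c)"
proof (cases "P \<subseteq> farthest_ranked P \<kappa> c")
  case True
  then have "farthest_ranked P \<kappa> c = P" unfolding farthest_ranked_def by auto
  then show ?thesis using assms by simp
next
  case False
  let ?N = "P - farthest_ranked P \<kappa> c"
  have "finite ((\<lambda>x. dist x c) ` ?N)" "(\<lambda>x. dist x c) ` ?N \<noteq> {}" using assms False by auto
  from Max_in[OF this] obtain y where y1: "y \<in> ?N" "Max ((\<lambda>x. dist x c) ` ?N) = dist y c"
    by (rule imageE)
  have y: "y \<in> ?N" "\<And>x. x \<in> ?N \<Longrightarrow> dist x c \<le> dist y c"
    unfolding y1(2)[symmetric] using y1(1) assms by (auto intro: Max_ge)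
  have "{x \<in> P. dist y c < dist x c} \<subseteq> farthest_ranked P \<kappa> c"
    using y(2) by force
  then have "card {x \<in> P. dist y c < dist x c} \<le> card (farthest_ranked P \<kappa> c)"
    using assms by (intro card_mono) (auto simp: farthest_ranked_def)
  moreover have "\<kappa> < card {x \<in> P. dist y c < dist x c}"
    using y(1) unfolding farthest_ranked_def by auto
  ultimately show ?thesis by linarith
qed

text \<open>More than \<open>t\<close> sample points are at least as far as the nearest ranked point
  \<open>x\<close>, so the estimate reaches the distance of \<open>x\<close>; at most
  \<open>\<kappa>\<close> points of \<open>P\<close> are strictly farther.\<close>

lemma kth_largest_covers:
  fixes \<kappa> :: real
  assumes fin: "finite P" and hits: "t < hits (farthest_ranked P \<kappa> c) ys"
  shows "card P - \<kappa> \<le> card (P \<inter> cball c (kth_largest (t + 1) (map (\<lambda>y. dist y c) ys)))"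
proof -
  let ?H = "farthest_ranked P \<kappa> c" and ?l = "kth_largest (t + 1) (map (\<lambda>y. dist y c) ys)"
  have "?H \<noteq> {}" using hits unfolding hits_def by auto
  moreover have "finite ?H" using fin unfolding farthest_ranked_def by auto
  ultimately have "arg_min_on (\<lambda>y. dist y c) ?H \<in> ?H"
      "\<And>y. y \<in> ?H \<Longrightarrow> dist (arg_min_on (\<lambda>y. dist y c) ?H) c \<le> dist y c"
    using arg_min_if_finite(1)[of ?H "\<lambda>y. dist y c"] arg_min_least[of ?H _ "\<lambda>y. dist y c"]
    by simp_all
  then obtain x where x: "x \<in> ?H" "\<And>y. y \<in> ?H \<Longrightarrow> dist x c \<le> dist y c"
    by (rule that)
  have "hits ?H ys \<le> length (filter (\<lambda>r. dist x c \<le> r) (map (\<lambda>y. dist y c) ys))"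
    unfolding hits_def by (induction ys) (auto dest: x(2))
  then have "dist x c \<le> ?l"
    using hits by (intro kth_largest_ge) auto
  then have "P - {y \<in> P. dist x c < dist y c} \<subseteq> P \<inter> cball c ?l"
    by (auto simp: dist_commute)
  then have "card (P - {y \<in> P. dist x c < dist y c}) \<le> card (P \<inter> cball c ?l)"
    using fin by (intro card_mono) auto
  moreover have "card (P - {y \<in> P. dist x c < dist y c}) = card P - card {y \<in> P. dist x c < dist y c}"
    using fin by (intro card_Diff_subset) auto
  moreover have "card {y \<in> P. dist x c < dist y c} \<le> card P"
    using fin by (intro card_mono) auto
  moreover have "card {y \<in> P. dist x c < dist y c} \<le> \<kappa>"
    using x(1) unfolding farthest_ranked_def by simp
  ultimately show ?thesis by linarith
qed

subsection \<open>The algorithm\<close>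

locale outlier_sampling =
  fixes P Popt :: "'a::euclidean_space set"
    and \<gamma> \<epsilon> \<eta>\<^sub>1 \<eta>\<^sub>2 \<delta> C\<^sub>1 C\<^sub>2 :: real
    and z n' n'' t' t'' :: nat
    and ctr :: "'a set \<Rightarrow> 'a"
    and far :: "'a \<Rightarrow> 'a list \<Rightarrow> 'a multiset"
  assumes fin: "finite P" and ne: "P \<noteq> {}"
    and gamma: "0 < \<gamma>" "\<gamma> < 1" and eps: "0 < \<epsilon>"
    and eta1: "0 < \<eta>\<^sub>1" "\<eta>\<^sub>1 < 1" and eta2: "0 < \<eta>\<^sub>2" "\<eta>\<^sub>2 < 1"
    and delta: "0 < \<delta>" "\<delta> < \<gamma> / 3"
    and opt: "outlier_opt P \<gamma> Popt"
    and z: "real z = 2 / \<epsilon> + 1"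
    and n': "C\<^sub>1 \<ge> 10 ^ 9" "real n' = C\<^sub>1 * (1 / \<delta> * ln (1 / \<eta>\<^sub>1))"
    and n'': "C\<^sub>2 \<ge> 10 ^ 9" "real n'' = C\<^sub>2 * (\<gamma> / \<delta>\<^sup>2 * ln (1 / \<eta>\<^sub>2))"
    and t': "real t' = 3 / 2 * (\<delta> / 5 + \<gamma>) * real n'"
    and t'': "real t'' = (1 + \<delta> / (5 * \<gamma>))\<^sup>2 * \<gamma> * real n''"
    and ctr: "\<And>T. T \<subseteq> P \<Longrightarrow> T \<noteq> {} \<Longrightarrow>
      approx_MEB_center (\<epsilon> / (2 + \<epsilon>) * (\<epsilon> / (1 + \<epsilon>))) T (ctr T)"
    and far: "\<And>c xs. farthest_points t' c xs (far c xs)"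
begin

abbreviation "R \<equiv> Rad Popt"
abbreviation "unif \<equiv> pmf_of_set P"

text \<open>Half of the ratio of \<open>n' * \<delta> / 5\<close> to the number \<open>t'\<close> of
  points to be selected.\<close>

definition quot :: real where "quot = (\<delta> / 5) / (3 * (\<gamma> + \<delta> / 5))"

definition radius_est :: "'a \<Rightarrow> 'a list \<Rightarrow> real" where
  "radius_est c ys = kth_largest (t'' + 1) (map (\<lambda>y. dist y c) ys)"

definition covers :: "'a \<times> real \<Rightarrow> bool" where
  "covers b \<longleftrightarrow> (1 - \<delta> - \<gamma>) * real (card P) \<le> real (card (P \<inter> cball (fst b) (snd b)))"

lemma Popt: "Popt \<subseteq> P" "Popt \<noteq> {}" "finite Popt" "real (card Popt) = (1 - \<gamma>) * real (card P)"
proof -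
  show *: "Popt \<subseteq> P" "real (card Popt) = (1 - \<gamma>) * real (card P)"
    using opt unfolding outlier_opt_def by auto
  then show "finite Popt" using fin finite_subset by blast
  have "0 < real (card Popt)" using * gamma fin ne by (simp add: card_gt_0_iff)
  then show "Popt \<noteq> {}" by auto
qed

lemma card_P_pos: "0 < real (card P)"
  using fin ne by (simp add: card_gt_0_iff)

lemma prob_unif: "measure_pmf.prob unif S = card (P \<inter> S) / card P"
  using fin ne by (simp add: measure_pmf_of_set)

lemma finite_unif: "finite (set_pmf unif)"
  using fin ne by simp

lemma set_sample: "xs \<in> set_pmf (replicate_pmf k unif) \<longleftrightarrow> set xs \<subseteq> P \<and> length xs = k"
  using fin ne by (auto simp: set_replicate_pmf)

text \<open>From \<open>1 - \<eta> \<le> ln (1 / \<eta>)\<close>; the divisor is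
  \<open>10^9 / 5\<close>. This serves samples too small for concentration.\<close>

lemma one_minus_eta1: "1 - \<eta>\<^sub>1 \<le> (n' * \<delta> / 5) / 200000000"
proof -
  have "1 - \<eta>\<^sub>1 \<le> ln (1 / \<eta>\<^sub>1)" using ln_le_minus_one[OF eta1(1)] eta1 by (simp add: ln_div)
  moreover have "10 ^ 9 * ln (1 / \<eta>\<^sub>1) \<le> C\<^sub>1 * ln (1 / \<eta>\<^sub>1)"
    using n' eta1 by (intro mult_right_mono) (auto simp: ln_div)
  moreover have "n' * \<delta> = C\<^sub>1 * ln (1 / \<eta>\<^sub>1)" using n' delta by simp
  ultimately show ?thesis by simp
qed

text \<open>In these parameters \<open>t''\<close> is \<open>(1 + a)^2 * g\<close>, the masses
  \<open>\<gamma> + \<delta> / 5\<close> and \<open>\<gamma> + \<delta>\<close> give the mean hit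
  counts \<open>g * (1 + a)\<close> and \<open>g * (1 + 5 * a)\<close>, and
  \<open>\<delta> < \<gamma> / 3\<close> becomes \<open>a < 1 / 15\<close>.\<close>

definition a where "a = \<delta> / (5 * \<gamma>)"
definition g where "g = \<gamma> * n''"

lemma one_minus_eta2: "1 - \<eta>\<^sub>2 \<le> a\<^sup>2 * g / 40000000"
proof -
  have "1 - \<eta>\<^sub>2 \<le> ln (1 / \<eta>\<^sub>2)" using ln_le_minus_one[OF eta2(1)] eta2 by (simp add: ln_div)
  moreover have "10 ^ 9 * ln (1 / \<eta>\<^sub>2) \<le> C\<^sub>2 * ln (1 / \<eta>\<^sub>2)"
    using n'' eta2 by (intro mult_right_mono) (auto simp: ln_div)
  moreover have "25 * (a\<^sup>2 * g) = C\<^sub>2 * ln (1 / \<eta>\<^sub>2)"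
    unfolding a_def g_def n'' using delta gamma by (simp add: power2_eq_square)
  ultimately show ?thesis by simp
qed

lemma n'_pos: "0 < n'"
proof -
  have "0 < real n'" unfolding n'(2) using n'(1) eta1 delta by (intro mult_pos_pos) auto
  then show ?thesis by simp
qed

lemma n''_pos: "0 < n''"
proof -
  have "0 < real n''" unfolding n''(2) using n''(1) eta2 delta gamma by (intro mult_pos_pos) auto
  then show ?thesis by simp
qed

lemma a: "0 < a" "a < 1 / 15" and g: "0 < g" and ga: "g * a = \<delta> / 5 * n''" and t_ga: "real t'' = (1 + a)\<^sup>2 * g"
  unfolding t'' using delta gamma n''_pos by (auto simp: a_def g_def field_simps)

lemma g_mult: "g * (1 + 5 * a) = n'' * (\<gamma> + \<delta>)"
proof -
  have "g * (1 + 5 * a) = g + 5 * (g * a)" by (simp add: algebra_simps)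
  then show ?thesis unfolding ga by (simp add: algebra_simps g_def)
qed

lemma quot_a: "quot = a / (3 * (1 + a))"
  unfolding a_def quot_def using delta gamma by (simp add: field_simps)

lemma farthest_ranked_mass:
  assumes "\<gamma> + \<delta> < 1"
  shows "g * (1 + 5 * a) \<le> n'' * measure_pmf.prob unif (farthest_ranked P ((\<gamma> + \<delta>) * card P) c)"
proof -
  let ?H = "farthest_ranked P ((\<gamma> + \<delta>) * card P) c"
  have "(\<gamma> + \<delta>) * card P \<le> card ?H"
    using assms mult_right_mono[of "\<gamma> + \<delta>" 1 "real (card P)"]
    by (intro card_farthest_ranked_ge fin) auto
  moreover have "P \<inter> ?H = ?H" unfolding farthest_ranked_def by auto
  ultimately have "\<gamma> + \<delta> \<le> measure_pmf.prob unif ?H"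
    unfolding prob_unif using card_P_pos by (simp add: pos_le_divide_eq)
  then have "n'' * (\<gamma> + \<delta>) \<le> n'' * measure_pmf.prob unif ?H" by (intro mult_left_mono) auto
  moreover have "g * (1 + 5 * a) = n'' * (\<gamma> + \<delta>)"
    by (rule g_mult)
  ultimately show ?thesis by simp
qed

lemma covers_if_hits:
  assumes "t'' < hits (farthest_ranked P ((\<gamma> + \<delta>) * card P) c) ys"
  shows "covers (c, radius_est c ys)"
  using kth_largest_covers[OF fin assms] unfolding covers_def radius_est_def by (simp add: algebra_simps)

text \<open>The number of points to be covered is then at most 0. This case is separate because a
  set of mass \<open>\<gamma> + \<delta>\<close> need not exist in \<open>P\<close>.\<close>

lemma covers_if_large: "1 \<le> \<gamma> + \<delta> \<Longrightarrow> covers b"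
  unfolding covers_def
  by (rule order_trans[of _ 0]) (auto intro: mult_nonpos_nonneg)

text \<open>The factor 12/13 lost here is regained by the factor 13/12 in the bound for \<open>select\<close>; this
  slack is what lets second moments replace exponential tail bounds.\<close>

lemma prob_covers:
  "12 / 13 * (1 - \<eta>\<^sub>2) \<le> measure_pmf.prob (replicate_pmf n'' unif) {ys. covers (c, radius_est c ys)}"
proof (cases "\<gamma> + \<delta> < 1")
  case True
  have "12 / 13 * (1 - \<eta>\<^sub>2) \<le> measure_pmf.prob (replicate_pmf n'' unif)
      {ys. t'' < hits (farthest_ranked P ((\<gamma> + \<delta>) * card P) c) ys}"
    using eta2 one_minus_eta2
    by (intro prob_hits_greater[OF finite_unif a g t_ga farthest_ranked_mass[OF True]]) auto
  also have "\<dots> \<le> measure_pmf.prob (replicate_pmf n'' unif) {ys. covers (c, radius_est c ys)}"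
    by (intro measure_pmf.finite_measure_mono) (auto simp: covers_if_hits)
  finally show ?thesis .
next
  case False
  then show ?thesis using covers_if_large eta2 by simp
qed

text \<open>At most \<open>t''\<close> hits of the points outside the ball make the estimate small;
  more than \<open>t''\<close> hits of the ranked set, which contains them, make it cover. For the
  joint event the weaker bound with factor \<open>quot\<close> suffices, since a good round does not
  depend on the choice of \<open>q\<close>.\<close>

lemma prob_covers_small:
  assumes few: "card {x \<in> P. (1 + \<epsilon>) * R < dist x c} \<le> (\<gamma> + \<delta> / 5) * card P"
  shows "(1 - \<eta>\<^sub>2) * quot \<le> measure_pmf.prob (replicate_pmf n'' unif)
     {ys. covers (c, radius_est c ys) \<and> radius_est c ys \<le> (1 + \<epsilon>) * R}"
proof -
  define F where "F = {x \<in> P. (1 + \<epsilon>) * R < dist x c}"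
  have R0: "0 \<le> (1 + \<epsilon>) * R" using Rad_nonneg[OF Popt(3,2)] eps by simp
  have small: "radius_est c ys \<le> (1 + \<epsilon>) * R" if "set ys \<subseteq> P" "hits F ys \<le> t''" for ys
    unfolding radius_est_def
  proof (rule kth_largest_le[OF _ R0])
    have "length (filter (\<lambda>x. (1 + \<epsilon>) * R < x) (map (\<lambda>y. dist y c) ys)) = hits F ys"
      using that(1) unfolding hits_def F_def by (induction ys) auto
    then show "length (filter (\<lambda>x. (1 + \<epsilon>) * R < x) (map (\<lambda>y. dist y c) ys)) \<le> t''"
      using that(2) by simp
  qed
  have "measure_pmf.prob unif F \<le> \<gamma> + \<delta> / 5"
    unfolding prob_unif using few card_P_pos by (simp add: F_def pos_divide_le_eq Int_def conj_ac cong: conj_cong)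
  then have "n'' * measure_pmf.prob unif F \<le> n'' * (\<gamma> + \<delta> / 5)" by (intro mult_left_mono) auto
  also have "\<dots> = g * (1 + a)" unfolding distrib_left ga by (simp add: g_def mult.commute)
  finally have F: "n'' * measure_pmf.prob unif F \<le> g * (1 + a)" .
  show ?thesis
  proof (cases "\<gamma> + \<delta> < 1")
    case True
    let ?H = "farthest_ranked P ((\<gamma> + \<delta>) * card P) c"
    have sub: "F \<subseteq> ?H"
    proof
      fix x assume x: "x \<in> F"
      then have "{y \<in> P. dist x c < dist y c} \<subseteq> F" unfolding F_def by auto
      then have "card {y \<in> P. dist x c < dist y c} \<le> card F"
        using fin unfolding F_def by (intro card_mono) auto
      then have "real (card {y \<in> P. dist x c < dist y c}) \<le> (\<gamma> + \<delta> / 5) * card P"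
        using few unfolding F_def by linarith
      also have "\<dots> \<le> (\<gamma> + \<delta>) * card P" using delta by (intro mult_right_mono) auto
      finally show "x \<in> ?H" using x unfolding farthest_ranked_def F_def by simp
    qed
    have "(\<gamma> + \<delta>) * n'' \<le> 1 * real n''" using True by (intro mult_right_mono) auto
    then have "g * (1 + 5 * a) \<le> n''" unfolding g_mult by (simp add: mult.commute)
    then have "(1 - \<eta>\<^sub>2) * quot \<le> measure_pmf.prob (replicate_pmf n'' unif) {ys. hits F ys \<le> t'' \<and> t'' < hits ?H ys}"
      unfolding quot_a using eta2 one_minus_eta2
      by (intro prob_hits_between[OF finite_unif a g t_ga _ sub F farthest_ranked_mass[OF True]]) auto
    also have "\<dots> \<le> measure_pmf.prob (replicate_pmf n'' unif)
       {ys. covers (c, radius_est c ys) \<and> radius_est c ys \<le> (1 + \<epsilon>) * R}"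
      by (rule prob_mono_set_pmf) (use small covers_if_hits in \<open>auto simp: set_sample\<close>)
    finally show ?thesis .
  next
    case False
    have "(1 - \<eta>\<^sub>2) * quot \<le> measure_pmf.prob (replicate_pmf n'' unif) {ys. hits F ys \<le> t''}"
      unfolding quot_a using eta2 one_minus_eta2
      by (intro prob_hits_le[OF finite_unif a g t_ga F]) auto
    also have "\<dots> \<le> measure_pmf.prob (replicate_pmf n'' unif)
       {ys. covers (c, radius_est c ys) \<and> radius_est c ys \<le> (1 + \<epsilon>) * R}"
      by (rule prob_mono_set_pmf) (use False small covers_if_large in \<open>auto simp: set_sample\<close>)
    finally show ?thesis .
  qed
qed

section \<open>The point added to T\<close>

definition select :: "'a \<Rightarrow> 'a pmf" where
  "select c = bind_pmf (replicate_pmf n' unif) (\<lambda>xs. pmf_of_multiset (far c xs))"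

lemma size_far:
  assumes "xs \<in> set_pmf (replicate_pmf n' unif)"
  shows "far c xs \<noteq> {#}" "size (far c xs) \<le> t'" "set_mset (far c xs) \<subseteq> P"
proof -
  have "0 < real t'" unfolding t' using delta gamma n'_pos by simp
  then have "0 < min t' n'" using n'_pos by simp
  moreover have "size (far c xs) = min t' n'"
    using far[of c xs] assms unfolding farthest_points_def by (simp add: set_sample)
  ultimately show "far c xs \<noteq> {#}" "size (far c xs) \<le> t'" by auto
  show "set_mset (far c xs) \<subseteq> P"
    using far[of c xs] assms unfolding farthest_points_def
    by (auto simp: set_sample dest!: set_mset_mono subsetD)
qed

lemma set_select: "set_pmf (select c) \<subseteq> P"
  unfolding select_def using size_far by fastforce

text \<open>Only \<open>\<gamma> * card P\<close> points are outliers, so \<open>G\<close> has mass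
  at least \<open>\<delta> / 5\<close>. Given the sample, \<open>q\<close> lies in \<open>G\<close>
  with probability at least \<open>m xs / t'\<close>. As \<open>x / t' = 2 * quot\<close>, the
  factor 13/24 of the expectation bound becomes 13/12.\<close>

lemma prob_select:
  assumes many: "(\<gamma> + \<delta> / 5) * card P < card {x \<in> P. (1 + \<epsilon>) * R < dist x c}"
  shows "13 / 12 * (1 - \<eta>\<^sub>1) * quot \<le> measure_pmf.prob (select c) {x \<in> Popt. (1 + \<epsilon>) * R < dist x c}"
proof -
  define G where "G = {x \<in> Popt. (1 + \<epsilon>) * R < dist x c}"
  define m where "m = (\<lambda>xs. real (size (filter_mset (\<lambda>x. x \<in> G) (far c xs))))"
  define x where "x = n' * \<delta> / 5"
  have cO: "card (P - Popt) = \<gamma> * card P"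
    using Popt fin card_mono[OF fin Popt(1)] by (simp add: card_Diff_subset algebra_simps)
  have "{x \<in> P. (1 + \<epsilon>) * R < dist x c} \<subseteq> G \<union> (P - Popt)" unfolding G_def by auto
  then have "card {x \<in> P. (1 + \<epsilon>) * R < dist x c} \<le> card (G \<union> (P - Popt))"
    using fin Popt(3) unfolding G_def by (intro card_mono) auto
  also have "\<dots> \<le> card G + card (P - Popt)" by (rule card_Un_le)
  finally have "\<delta> / 5 * card P \<le> card G"
    using many cO by (simp add: algebra_simps)
  moreover have PG: "P \<inter> G = G" using Popt unfolding G_def by auto
  ultimately have pG: "\<delta> / 5 \<le> measure_pmf.prob unif G"
    unfolding prob_unif using card_P_pos by (simp add: pos_le_divide_eq)
  have pO: "measure_pmf.prob unif (P - Popt) = \<gamma>"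
    unfolding prob_unif using cO card_P_pos by (simp add: Int_absorb1)
  have x0: "0 < x" unfolding x_def using n'_pos delta by simp
  have "13 / 24 * (1 - \<eta>\<^sub>1) * x \<le> measure_pmf.expectation (replicate_pmf n' unif) m"
  proof (rule expectation_selected_ge[OF finite_unif, of G "P - Popt" x n' "\<gamma> * n'" t'])
    show "G \<inter> (P - Popt) = {}" unfolding G_def by auto
    show "x \<le> n' * measure_pmf.prob unif G"
      using mult_left_mono[OF pG, of "real n'"] unfolding x_def by simp
    show "15 * x \<le> \<gamma> * n'"
      unfolding x_def using delta mult_right_mono[of "3 * \<delta>" \<gamma> "real n'"] by (simp add: mult_ac)
    show "real t' = 3 / 2 * (\<gamma> * n' + x)" unfolding t' x_def by (simp add: algebra_simps)
    show "real (hits G xs) \<le> m xs \<or> real t' \<le> m xs + real (hits (P - Popt) xs)"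
      if "xs \<in> set_pmf (replicate_pmf n' unif)" for xs
      using farthest_points_selected[OF far _ G_def, of xs P] that unfolding m_def set_sample
      by (auto simp flip: of_nat_add)
    show "1 - \<eta>\<^sub>1 \<le> x / 200000000" using one_minus_eta1 unfolding x_def .
  qed (use eta1 x0 pO in \<open>auto simp: m_def\<close>)
  then have "13 / 24 * (1 - \<eta>\<^sub>1) * x / t' \<le> measure_pmf.expectation (replicate_pmf n' unif) m / t'"
    by (rule divide_right_mono) simp
  also have "13 / 24 * (1 - \<eta>\<^sub>1) * x / t' = 13 / 12 * (1 - \<eta>\<^sub>1) * quot"
  proof -
    define A where "A = \<gamma> + \<delta> / 5"
    have "0 < A" unfolding A_def using delta gamma by simp
    then have "x / t' = 2 * quot"
      unfolding t' x_def quot_def A_def[symmetric] add.commute[of "\<delta> / 5"] using n'_pos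
      by (simp add: field_simps)
    then have "13 / 24 * (1 - \<eta>\<^sub>1) * (x / t') = 13 / 12 * (1 - \<eta>\<^sub>1) * quot" by simp
    then show ?thesis by (simp only: times_divide_eq_right)
  qed
  also have "measure_pmf.expectation (replicate_pmf n' unif) m / t' =
      measure_pmf.expectation (replicate_pmf n' unif) (\<lambda>xs. m xs / t')"
    by simp
  also have "\<dots> \<le> measure_pmf.expectation (replicate_pmf n' unif)
      (\<lambda>xs. measure_pmf.prob (pmf_of_multiset (far c xs)) G)"
  proof (rule integral_mono_AE, unfold AE_measure_pmf_iff, safe)
    fix xs assume xs: "xs \<in> set_pmf (replicate_pmf n' unif)"
    show "m xs / t' \<le> measure_pmf.prob (pmf_of_multiset (far c xs)) G"
      unfolding prob_pmf_of_multiset[OF size_far(1)[OF xs]] m_def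
    proof (intro divide_left_mono mult_pos_pos)
      show "0 < real (size (far c xs))" using size_far(1)[OF xs] by (simp add: nonempty_has_size)
      then show "0 < real t'" using size_far(2)[OF xs, of c] by linarith
    qed (use size_far(2)[OF xs] in auto)
  qed (intro integrable_measure_pmf_finite finite_set_replicate_pmf finite_unif)+
  also have "\<dots> = measure_pmf.expectation (select c) (indicator G)"
    unfolding select_def
    by (subst expectation_bind_pmf_finite)
       (auto simp: finite_set_replicate_pmf finite_unif size_far)
  also have "\<dots> = measure_pmf.prob (select c) G" by simp
  finally show ?thesis unfolding G_def .
qed

text \<open>The bound is the one of Badoiu and Clarkson, \<open>Rad T / M \<ge> j / (j + 2)\<close> after \<open>j\<close> insertions of
  points at distance more than \<open>M\<close> from the current center. With \<open>M = (1 + 2 / z) R\<close> it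
  contradicts \<open>Rad T \<le> R\<close> at \<open>j = z\<close>.\<close>

definition invariant :: "nat \<Rightarrow> 'a set \<Rightarrow> bool" where
  "invariant j T \<longleftrightarrow> T \<subseteq> Popt \<and> T \<noteq> {} \<and> (j = 0 \<or> (1 + 2 / z) * R * j < Rad T * (j + 2))"

lemma z_pos: "0 < z"
proof -
  have "0 < real z" unfolding z using eps by (simp add: add_pos_pos)
  then show ?thesis by simp
qed

lemma invariant_insert:
  assumes inv: "invariant j T" and q: "q \<in> Popt" "(1 + \<epsilon>) * R < dist q (ctr T)"
  shows "invariant (Suc j) (insert q T)"
proof -
  have T: "T \<subseteq> Popt" "T \<noteq> {}" "finite T" "T \<subseteq> P"
    using inv Popt finite_subset unfolding invariant_def by auto
  define \<xi> where "\<xi> = \<epsilon> / (2 + \<epsilon>) * (\<epsilon> / (1 + \<epsilon>))"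
  have \<xi>: "0 \<le> \<xi>" unfolding \<xi>_def using eps by simp
  have R0: "0 \<le> R" by (rule Rad_nonneg[OF Popt(3,2)])
  have "dist (ctr T) (MEB_center T) \<le> \<xi> * Rad T"
    using ctr[OF T(4,2)] unfolding approx_MEB_center_def \<xi>_def by (auto split: if_splits)
  also have "\<dots> \<le> \<xi> * R"
    using \<xi> Rad_mono[OF Popt(3) T(1,2)] by (intro mult_left_mono)
  finally have "dist (ctr T) (MEB_center T) \<le> \<xi> * R" .
  then have d: "(1 + \<epsilon> - \<xi>) * R < dist q (MEB_center T)"
    using q(2) dist_triangle[of q "ctr T" "MEB_center T"] dist_commute[of "ctr T" "MEB_center T"]
    by (simp add: algebra_simps)
  \<comment> \<open>The choice of \<open>z\<close> leaves exactly this margin for the error of the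
    approximate center; hence a point outside the ball about \<open>ctr T\<close> is farther than
    \<open>(1 + 2 / z) * R\<close> from the exact center.\<close>
  have "\<epsilon> - 2 / z = \<epsilon> / (2 + \<epsilon>) * \<epsilon>"
    unfolding z using eps by (simp add: field_simps)
  moreover have "\<xi> \<le> \<epsilon> / (2 + \<epsilon>) * \<epsilon>"
    unfolding \<xi>_def using eps by (intro mult_left_mono) (auto simp: field_simps)
  ultimately have "(1 + 2 / z) * R \<le> (1 + \<epsilon> - \<xi>) * R"
    using R0 by (intro mult_right_mono) linarith
  then have far_q: "(1 + 2 / z) * R < dist q (MEB_center T)" using d by linarith
  obtain K where K: "0 \<le> K" "(Rad T)\<^sup>2 + K\<^sup>2 \<le> (Rad (insert q T))\<^sup>2"
      "dist q (MEB_center T) - K \<le> Rad (insert q T)"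
    using Rad_insert[OF T(3,2)] by blast
  have RT: "0 \<le> Rad T" "0 \<le> Rad (insert q T)"
    using Rad_nonneg[OF T(3,2)] Rad_nonneg[of "insert q T"] T by auto
  \<comment> \<open>For \<open>j = 0\<close> the left side vanishes. The strict inequality would
    fail for a one-point \<open>T\<close>, hence the disjunct \<open>j = 0\<close> in the
    invariant.\<close>
  have "(1 + 2 / z) * R * j \<le> Rad T * (real j + 2)"
    using inv RT unfolding invariant_def by auto
  then have "(1 + 2 / z) * R * (real j + 1) < Rad (insert q T) * (real j + 3)"
    using RT K R0 far_q by (intro radius_growth) auto
  then show ?thesis
    using T q unfolding invariant_def by (simp add: algebra_simps)
qed

lemma not_invariant_z: "\<not> invariant z T"
proof
  assume inv: "invariant z T"
  then have "(1 + 2 / z) * R * z < Rad T * (real z + 2)"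
    using z_pos unfolding invariant_def by auto
  moreover have "(1 + 2 / z) * R * z = R * (real z + 2)"
    using z_pos by (simp add: field_simps)
  ultimately have "R < Rad T" by (simp add: add_pos_pos mult_less_cancel_right)
  then show False
    using Rad_mono[OF Popt(3), of T] inv unfolding invariant_def by auto
qed

section \<open>Success probability of the rounds\<close>

abbreviation "rounds \<equiv> meb_rounds P n' n'' t'' ctr far"
abbreviation "rate \<equiv> (1 - \<eta>\<^sub>1) * (1 - \<eta>\<^sub>2) * quot"

lemma rounds_Suc:
  "rounds (Suc k) T = bind_pmf (select (ctr T)) (\<lambda>q. bind_pmf (replicate_pmf n'' unif) (\<lambda>ys.
     map_pmf (\<lambda>bs. (ctr T, radius_est (ctr T) ys) # bs) (rounds k (insert q T))))"
  unfolding select_def radius_est_def by (simp add: bind_assoc_pmf map_pmf_def)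

lemma quot_pos: "0 < quot"
  unfolding quot_def using delta gamma by simp

lemma rate: "0 \<le> rate" "rate \<le> 12 / 13 * (1 - \<eta>\<^sub>2)"
proof -
  show "0 \<le> rate" using quot_pos eta1 eta2 by (intro mult_nonneg_nonneg) auto
  have "quot \<le> 12 / 13" unfolding quot_def using delta gamma by (simp add: field_simps)
  then have "(1 - \<eta>\<^sub>1) * quot \<le> 1 * (12 / 13)"
    using quot_pos eta1 by (intro mult_mono) auto
  then have "(1 - \<eta>\<^sub>2) * ((1 - \<eta>\<^sub>1) * quot) \<le> (1 - \<eta>\<^sub>2) * (12 / 13)"
    using eta2 by (intro mult_left_mono) auto
  then show "rate \<le> 12 / 13 * (1 - \<eta>\<^sub>2)" by (simp only: mult_ac)
qed

text \<open>The stages of a round are conditioned in turn: \<open>S\<close> on the added point,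
  \<open>Y\<close> on the second sample, \<open>B\<close> on the remaining rounds.\<close>

lemma prob_rounds_Suc_ge:
  assumes "0 \<le> r" and "\<And>q ys bs. q \<in> S \<Longrightarrow> ys \<in> Y \<Longrightarrow> bs \<in> B \<Longrightarrow> (ctr T, radius_est (ctr T) ys) # bs \<in> E"
    and "\<And>q. q \<in> S \<Longrightarrow> q \<in> P \<Longrightarrow> r \<le> measure_pmf.prob (rounds k (insert q T)) B"
  shows "measure_pmf.prob (select (ctr T)) S * (measure_pmf.prob (replicate_pmf n'' unif) Y * r)
     \<le> measure_pmf.prob (rounds (Suc k) T) E"
  unfolding rounds_Suc
proof (intro prob_bind_pmf_ge)
  fix q ys assume *: "q \<in> set_pmf (select (ctr T))" "q \<in> S" "ys \<in> Y"
  then have "r \<le> measure_pmf.prob (rounds k (insert q T)) B"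
    using assms(3) set_select by blast
  also have "\<dots> \<le> measure_pmf.prob (rounds k (insert q T)) ((\<lambda>bs. (ctr T, radius_est (ctr T) ys) # bs) -` E)"
    using assms(2)[OF *(2,3)] by (intro measure_pmf.finite_measure_mono) auto
  finally show "r \<le> measure_pmf.prob (map_pmf (\<lambda>bs. (ctr T, radius_est (ctr T) ys) # bs) (rounds k (insert q T))) E"
    by simp
qed (use assms(1) in auto)

text \<open>For the rounds after a good one: they only have to cover, whatever points are added, so
  \<open>T\<close> is arbitrary and \<open>S\<close> is everything.\<close>

lemma prob_rounds_cover:
  "rate ^ k \<le> measure_pmf.prob (rounds k T) {bs. \<forall>b\<in>set bs. covers b}"
proof (induction k arbitrary: T)
  case (Suc k)
  let ?Y = "{ys. covers (ctr T, radius_est (ctr T) ys)}"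
  have "rate ^ Suc k \<le> measure_pmf.prob (replicate_pmf n'' unif) ?Y * rate ^ k"
    using rate prob_covers[of "ctr T"] unfolding power_Suc by (intro mult_right_mono) auto
  also have "\<dots> = measure_pmf.prob (select (ctr T)) UNIV * (measure_pmf.prob (replicate_pmf n'' unif) ?Y * rate ^ k)"
    by simp
  also have "\<dots> \<le> measure_pmf.prob (rounds (Suc k) T) {bs. \<forall>b\<in>set bs. covers b}"
    by (rule prob_rounds_Suc_ge[OF _ _ Suc]) (use rate in auto)
  finally show ?case .
qed simp

text \<open>Every ball has to cover, since the minimum may be attained in any round; a single small
  radius bounds the minimum.\<close>

definition good :: "('a \<times> real) list \<Rightarrow> bool" where
  "good bs \<longleftrightarrow> (\<forall>b\<in>set bs. covers b) \<and> (\<exists>b\<in>set bs. snd b \<le> (1 + \<epsilon>) * R)"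

text \<open>Induction on the remaining rounds. With few points outside the ball, the present round
  supplies the small radius and later ones only have to cover. Otherwise the added point extends the
  invariant, which cannot survive \<open>z\<close> rounds.\<close>

lemma prob_rounds_good:
  assumes "invariant j T" "j + k = z"
  shows "rate ^ k \<le> measure_pmf.prob (rounds k T) {bs. good bs}"
  using assms
proof (induction k arbitrary: j T)
  case 0
  then show ?case using not_invariant_z by simp
next
  case (Suc k)
  let ?c = "ctr T"
  show ?case
  proof (cases "card {x \<in> P. (1 + \<epsilon>) * R < dist x ?c} \<le> (\<gamma> + \<delta> / 5) * card P")
    case True
    let ?Y = "{ys. covers (?c, radius_est ?c ys) \<and> radius_est ?c ys \<le> (1 + \<epsilon>) * R}"
    \<comment> \<open>Any \<open>q\<close> will do here: \<open>1 - \<eta>\<^sub>1\<close> is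
      replaced by 1, and \<open>quot\<close> is spent on the joint event \<open>?Y\<close>.\<close>
    have "rate \<le> 1 * (1 - \<eta>\<^sub>2) * quot"
      using quot_pos eta1 eta2 by (intro mult_right_mono) auto
    then have "rate ^ Suc k \<le> measure_pmf.prob (replicate_pmf n'' unif) ?Y * rate ^ k"
      using rate prob_covers_small[OF True] unfolding power_Suc by (intro mult_right_mono) auto
    also have "\<dots> = measure_pmf.prob (select ?c) UNIV * (measure_pmf.prob (replicate_pmf n'' unif) ?Y * rate ^ k)"
      by simp
    also have "\<dots> \<le> measure_pmf.prob (rounds (Suc k) T) {bs. good bs}"
      by (rule prob_rounds_Suc_ge[OF _ _ prob_rounds_cover]) (use rate in \<open>auto simp: good_def\<close>)
    finally show ?thesis .
  next
    case False
    let ?Y = "{ys. covers (?c, radius_est ?c ys)}" and ?S = "{x \<in> Popt. (1 + \<epsilon>) * R < dist x ?c}"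
    have "u * v * w = (13 / 12 * u * w) * (12 / 13 * v)" for u v w :: real by simp
    then have "rate = (13 / 12 * (1 - \<eta>\<^sub>1) * quot) * (12 / 13 * (1 - \<eta>\<^sub>2))" .
    also have "\<dots> \<le> measure_pmf.prob (select ?c) ?S * measure_pmf.prob (replicate_pmf n'' unif) ?Y"
      using prob_select[of ?c] prob_covers[of ?c] False eta2 by (intro mult_mono) auto
    finally have "rate ^ Suc k \<le>
        measure_pmf.prob (select ?c) ?S * measure_pmf.prob (replicate_pmf n'' unif) ?Y * rate ^ k"
      using rate unfolding power_Suc by (intro mult_right_mono) auto
    also have "\<dots> = measure_pmf.prob (select ?c) ?S * (measure_pmf.prob (replicate_pmf n'' unif) ?Y * rate ^ k)"
      by (rule mult.assoc)
    also have "\<dots> \<le> measure_pmf.prob (rounds (Suc k) T) {bs. good bs}"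
    proof (rule prob_rounds_Suc_ge)
      fix q assume "q \<in> ?S"
      then have "invariant (Suc j) (insert q T)"
        using invariant_insert[OF Suc.prems(1)] by auto
      then show "rate ^ k \<le> measure_pmf.prob (rounds k (insert q T)) {bs. good bs}"
        using Suc.IH Suc.prems(2) by auto
    qed (use rate in \<open>auto simp: good_def\<close>)
    finally show ?thesis .
  qed
qed

lemma length_rounds: "bs \<in> set_pmf (rounds k T) \<Longrightarrow> length bs = k"
  by (induction k arbitrary: T bs) auto

lemma good_arg_min:
  assumes "good bs" "length bs = z"
  shows "outlier_approx P \<gamma> Popt \<epsilon> \<delta> (bs ! arg_min_on (\<lambda>i. snd (bs ! i)) {..<z})"
proof -
  let ?i = "arg_min_on (\<lambda>i. snd (bs ! i)) {..<z}"
  have fin': "finite {..<z}" "{..<z} \<noteq> {}" using z_pos by auto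
  have i: "?i < z" using arg_min_if_finite(1)[OF fin'] by simp
  obtain k where k: "k < z" "snd (bs ! k) \<le> (1 + \<epsilon>) * R"
    using assms unfolding good_def by (metis in_set_conv_nth)
  have "snd (bs ! ?i) \<le> snd (bs ! k)"
    using arg_min_least[OF fin', of k "\<lambda>i. snd (bs ! i)"] k by simp
  moreover have "covers (bs ! ?i)" using assms i unfolding good_def by simp
  ultimately show ?thesis using k unfolding outlier_approx_def covers_def by auto
qed

text \<open>The factor \<open>1 - \<gamma>\<close> is the probability that the initial point lies in
  \<open>Popt\<close>, which starts the invariant at \<open>j = 0\<close>.\<close>

theorem prob_outlier_approx:
  "(1 - \<gamma>) * rate ^ z \<le> measure_pmf.prob (meb_algorithm P n' n'' t'' ctr far z)
     {B. outlier_approx P \<gamma> Popt \<epsilon> \<delta> B}"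
proof -
  have "P \<inter> Popt = Popt" using Popt by auto
  then have "(1 - \<gamma>) * rate ^ z = measure_pmf.prob unif Popt * rate ^ z"
    unfolding prob_unif using Popt(4) card_P_pos by simp
  also have "\<dots> \<le> measure_pmf.prob (meb_algorithm P n' n'' t'' ctr far z) {B. outlier_approx P \<gamma> Popt \<epsilon> \<delta> B}"
    unfolding meb_algorithm_def
  proof (rule prob_bind_pmf_ge)
    fix p assume "p \<in> Popt"
    then have "rate ^ z \<le> measure_pmf.prob (rounds z {p}) {bs. good bs} * 1"
      using prob_rounds_good[of 0 "{p}" z] unfolding invariant_def by simp
    also have "\<dots> \<le> measure_pmf.prob (bind_pmf (rounds z {p})
        (\<lambda>bs. return_pmf (bs ! arg_min_on (\<lambda>i. snd (bs ! i)) {..<z}))) {B. outlier_approx P \<gamma> Popt \<epsilon> \<delta> B}"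
      by (rule prob_bind_pmf_ge) (auto simp: good_arg_min length_rounds)
    finally show "rate ^ z \<le> measure_pmf.prob (bind_pmf (rounds z {p})
        (\<lambda>bs. return_pmf (bs ! arg_min_on (\<lambda>i. snd (bs ! i)) {..<z}))) {B. outlier_approx P \<gamma> Popt \<epsilon> \<delta> B}" .
  qed (use rate in simp)
  finally show ?thesis .
qed

end

theorem theorem6:
  fixes P Popt :: "(real ^ 'd) set"
    and \<gamma> \<epsilon> \<eta>\<^sub>1 \<eta>\<^sub>2 \<delta> s C\<^sub>1 C\<^sub>2 :: real
    and z n' n'' t' t'' :: nat
    and ctr :: "(real ^ 'd) set \<Rightarrow> real ^ 'd"
    and far :: "real ^ 'd \<Rightarrow> (real ^ 'd) list \<Rightarrow> (real ^ 'd) multiset"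
  assumes "finite P" "P \<noteq> {}"
    and "0 < \<gamma>" "\<gamma> < 1" "0 < \<epsilon>" "\<epsilon> < 1"
    and "0 < \<eta>\<^sub>1" "\<eta>\<^sub>1 < 1" "0 < \<eta>\<^sub>2" "\<eta>\<^sub>2 < 1"
    and "0 < \<delta>" "\<delta> < \<gamma> / 3"
    and "outlier_opt P \<gamma> Popt"
    and "real z = 2 / \<epsilon> + 1"
    and "C\<^sub>1 \<ge> 10 ^ 9" "real n' = C\<^sub>1 * (1 / \<delta> * ln (1 / \<eta>\<^sub>1))"
    and "C\<^sub>2 \<ge> 10 ^ 9" "real n'' = C\<^sub>2 * (\<gamma> / \<delta>\<^sup>2 * ln (1 / \<eta>\<^sub>2))"
    and "real t' = 3 / 2 * (\<delta> / 5 + \<gamma>) * real n'"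
    and "real t'' = (1 + \<delta> / (5 * \<gamma>))\<^sup>2 * \<gamma> * real n''"
    and "s = \<epsilon> / (2 + \<epsilon>)"
    and "\<And>T. T \<subseteq> P \<Longrightarrow> T \<noteq> {} \<Longrightarrow> approx_MEB_center (s * (\<epsilon> / (1 + \<epsilon>))) T (ctr T)"
    and "\<And>c xs. farthest_points t' c xs (far c xs)"
  shows "measure_pmf.prob (meb_algorithm P n' n'' t'' ctr far z)
           {B. outlier_approx P \<gamma> Popt \<epsilon> \<delta> B}
         \<ge> (1 - \<gamma>) * ((1 - \<eta>\<^sub>1) * (1 - \<eta>\<^sub>2) * ((\<delta> / 5) / (3 * (\<gamma> + \<delta> / 5)))) ^ z"
proof -
  interpret outlier_sampling P Popt \<gamma> \<epsilon> \<eta>\<^sub>1 \<eta>\<^sub>2 \<delta> C\<^sub>1 C\<^sub>2 z n' n'' t' t'' ctr far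
    using assms by unfold_locales auto
  show ?thesis
    using prob_outlier_approx unfolding quot_def .
qed

end
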